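(* Let $F=\bigsqcup_{\alpha=1}^{j}T_\alpha$ be a forest with $i$ nodes and $m=i+j$. Let $g\in\operatorname{Aut}(F)$ and $\mathfrak g\in\mathfrak G(F)$, and let $w_1,w_2$ be weights on $F$ with $w_2=g(\mathfrak g(w_1))$. Then $\operatorname{im}\varphi(F,w_1)=\operatorname{im}\varphi(F,w_2)$ as subsets of $\mathbb P^m(\mathbb C)$.
   Context: Trees, forests. A tree is a finite rooted tree in which every node has at most $2$ right neighbors (children). A node is final if it has no child, and a ramification node if it has exactly two children. The depth of a node is its distance to the root; the depth $d_\alpha$ of a tree $T_\alpha$ is the maximal depth of its nodes. A forest is a disjoint union of trees. $\operatorname{Aut}(F)$ is the group of permutations of nodes of $F$ preserving the roots and the edges. Weights. A (multiplicative) weight on a tree $T$ of depth $d$ is a function $w$ from the nodes of $T$ to the group of $2^d$-th roots of unity in $\mathbb C^*$ such that: $w(\text{root})=1$; if $y$ is the parent of $x$ then $w(y)=w(x)^2$; if $x_1,x_2$ are the two children of a ramification node then $w(x_2)=-w(x_1)$. A weight on a forest is a choice of a weight on each of its trees. If $x$ has depth $k$ then $w(x)=\exp(2\pi\sqrt{-1}\,w_a(x)/2^k)$ for a unique $w_a(x)\in\mathbb Z/2^k$ (additive form). Actions. $\operatorname{Aut}(F)$ acts on weights by $(g(w))(x)=w(g^{-1}(x))$. The group $\mathfrak G(F)=\prod_{\alpha=1}^j\mathbb Z/2^{d_\alpha}$ acts on weights by: for $\mathfrak g=(\mathfrak g_1,\dots,\mathfrak g_j)$ and a node $x$ of $T_\alpha$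 of depth $k$, $(\mathfrak g(w_a))(x)=\bar{\mathfrak g}_\alpha+w_a(x)\in\mathbb Z/2^k$, where $\bar{\mathfrak g}_\alpha$ is the image of $\mathfrak g_\alpha$ under $\mathbb Z/2^{d_\alpha}\to\mathbb Z/2^k$. The map $\varphi(F,w):(\mathbb P^1)^j\to\mathbb P^m(\mathbb C)$. For $c_1,\dots,c_j$ put $$\mathfrak P(Y)=\prod_{u\ \text{final}}\bigl(Y^2-w(u)\,c_{\alpha}^{2^{d_\alpha-k}}\bigr)\ \prod_{u}\bigl(Y+w(u')\,c_\alpha^{2^{d_\alpha-k-1}}\bigr),$$ where the first product is over final nodes $u$ of $F$, the second over nodes $u$ that are neither final nor ramification nodes ($u'$ is the only child of $u$), $\alpha$ is the index of the tree containing $u$ and $k$ is the depth of $u$. This is monic in $Y$ of degree $m$; write $\mathfrak P(Y)=\sum_{\kappa=0}^m\lambda_\kappa(c_1,\dots,c_j)Y^\kappa$. Then $\varphi(F,w)((c_1:1),\dots,(c_j:1))=(\lambda_0:\dots:\lambda_m)$, extended to $(\mathbb P^1)^j$ by homogenizing all $\lambda_\kappa$ separately in each pair $(c_\alpha,c'_\alpha)$ to the maximal degree of $c_\alpha$ occurring among $\lambda_0,\dots,\lambda_m$. *)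

theory Defs
  imports
    "HOL-Analysis.Analysis"
    "HOL-Algebra.Product_Groups"
    "HOL-Combinatorics.Permutations"
    "HOL-Library.Poly_Mapping"
    "HOL-Library.Disjoint_Sets"
    "HOL-Computational_Algebra.Polynomial"
begin

section \<open>Trees and forests\<close>

text \<open>Edges point from parent to child.\<close>

record 'a rtree =
  node_set :: "'a set"
  root_node :: 'a
  edge_set :: "('a \<times> 'a) set"

definition is_tree :: "'a rtree \<Rightarrow> bool" where
  "is_tree T \<longleftrightarrow>
     finite (node_set T) \<and> root_node T \<in> node_set T \<and>
     edge_set T \<subseteq> node_set T \<times> node_set T \<and>
     (\<forall>x. (x, root_node T) \<notin> edge_set T) \<and>
     (\<forall>y\<in>node_set T - {root_node T}. \<exists>!x. (x, y) \<in> edge_set T) \<and>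
     (\<forall>y\<in>node_set T. (root_node T, y) \<in> (edge_set T)\<^sup>*) \<and>
     (\<forall>x\<in>node_set T. card {y. (x, y) \<in> edge_set T} \<le> 2)"

definition node_depth :: "'a rtree \<Rightarrow> 'a \<Rightarrow> nat" where
  "node_depth T x = (LEAST n. (root_node T, x) \<in> edge_set T ^^ n)"

definition tree_depth :: "'a rtree \<Rightarrow> nat" where
  "tree_depth T = Max (node_depth T ` node_set T)"

text \<open>The trees of a forest are indexed by \<open>{1..num_trees F}\<close>; the values of
  \<^term>\<open>tree F\<close> outside this range are irrelevant.\<close>

record 'a forest =
  num_trees :: nat
  tree :: "nat \<Rightarrow> 'a rtree"

definition is_forest :: "'a forest \<Rightarrow> bool" where
  "is_forest F \<longleftrightarrow>
     (\<forall>\<alpha>\<in>{1..num_trees F}. is_tree (tree F \<alpha>)) \<and>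
     disjoint_family_on (\<lambda>\<alpha>. node_set (tree F \<alpha>)) {1..num_trees F}"

definition forest_nodes :: "'a forest \<Rightarrow> 'a set" where
  "forest_nodes F = (\<Union>\<alpha>\<in>{1..num_trees F}. node_set (tree F \<alpha>))"

definition forest_edges :: "'a forest \<Rightarrow> ('a \<times> 'a) set" where
  "forest_edges F = (\<Union>\<alpha>\<in>{1..num_trees F}. edge_set (tree F \<alpha>))"

definition forest_roots :: "'a forest \<Rightarrow> 'a set" where
  "forest_roots F = (\<lambda>\<alpha>. root_node (tree F \<alpha>)) ` {1..num_trees F}"

definition tree_index :: "'a forest \<Rightarrow> 'a \<Rightarrow> nat" where
  "tree_index F x = (THE \<alpha>. \<alpha> \<in> {1..num_trees F} \<and> x \<in> node_set (tree F \<alpha>))"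

definition depth :: "'a forest \<Rightarrow> 'a \<Rightarrow> nat" where
  "depth F x = node_depth (tree F (tree_index F x)) x"

definition children :: "'a forest \<Rightarrow> 'a \<Rightarrow> 'a set" where
  "children F x = {y. (x, y) \<in> forest_edges F}"

definition final_nodes :: "'a forest \<Rightarrow> 'a set" where
  "final_nodes F = {x \<in> forest_nodes F. children F x = {}}"

definition ramification_nodes :: "'a forest \<Rightarrow> 'a set" where
  "ramification_nodes F = {x \<in> forest_nodes F. card (children F x) = 2}"

definition only_child :: "'a forest \<Rightarrow> 'a \<Rightarrow> 'a" where
  "only_child F x = (THE y. y \<in> children F x)"

text \<open>An automorphism has to preserve the set of roots; it may permute isomorphic trees.\<close>

definition Aut :: "'a forest \<Rightarrow> ('a \<Rightarrow> 'a) set" where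
  "Aut F = {g. g permutes forest_nodes F \<and> g ` forest_roots F = forest_roots F \<and>
     (\<forall>x\<in>forest_nodes F. \<forall>y\<in>forest_nodes F.
        (g x, g y) \<in> forest_edges F \<longleftrightarrow> (x, y) \<in> forest_edges F)}"


section \<open>Weights\<close>

text \<open>Weights are total functions of which only the values at the nodes matter.\<close>

definition is_tree_weight :: "'a rtree \<Rightarrow> ('a \<Rightarrow> complex) \<Rightarrow> bool" where
  "is_tree_weight T w \<longleftrightarrow>
     (\<forall>x\<in>node_set T. w x ^ (2 ^ tree_depth T) = 1) \<and>
     w (root_node T) = 1 \<and>
     (\<forall>y x. (y, x) \<in> edge_set T \<longrightarrow> w y = (w x)\<^sup>2) \<and>
     (\<forall>y x1 x2. (y, x1) \<in> edge_set T \<longrightarrow> (y, x2) \<in> edge_set T \<longrightarrow> x1 \<noteq> x2 \<longrightarrow> w x2 = - w x1)"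

definition is_weight :: "'a forest \<Rightarrow> ('a \<Rightarrow> complex) \<Rightarrow> bool" where
  "is_weight F w \<longleftrightarrow> (\<forall>\<alpha>\<in>{1..num_trees F}. is_tree_weight (tree F \<alpha>) w)"

definition aut_act :: "('a \<Rightarrow> 'a) \<Rightarrow> ('a \<Rightarrow> complex) \<Rightarrow> 'a \<Rightarrow> complex" where
  "aut_act g w = (\<lambda>x. w (inv_into UNIV g x))"

text \<open>The elements of the group \<open>\<int>/n\<close>, i.e. \<^term>\<open>integer_mod_group n\<close>, are the
  residues \<open>0, \<dots>, n - 1\<close>; reduction \<open>\<int>/2\<^sup>d \<rightarrow> \<int>/2\<^sup>k\<close> is therefore \<open>\<lambda>a. a mod 2 ^ k\<close>.\<close>

definition additive_form :: "'a forest \<Rightarrow> ('a \<Rightarrow> complex) \<Rightarrow> 'a \<Rightarrow> int" where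
  "additive_form F w x =
     (THE a. a \<in> carrier (integer_mod_group (2 ^ depth F x)) \<and>
             w x = exp (2 * pi * \<i> * of_int a / 2 ^ depth F x))"

definition mult_form :: "'a forest \<Rightarrow> ('a \<Rightarrow> int) \<Rightarrow> 'a \<Rightarrow> complex" where
  "mult_form F a x = exp (2 * pi * \<i> * of_int (a x) / 2 ^ depth F x)"

definition shift_group :: "'a forest \<Rightarrow> (nat \<Rightarrow> int) monoid" where
  "shift_group F =
     product_group {1..num_trees F} (\<lambda>\<alpha>. integer_mod_group (2 ^ tree_depth (tree F \<alpha>)))"

definition shift_act_additive :: "'a forest \<Rightarrow> (nat \<Rightarrow> int) \<Rightarrow> ('a \<Rightarrow> int) \<Rightarrow> 'a \<Rightarrow> int" where
  "shift_act_additive F h a x =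
     (h (tree_index F x) mod 2 ^ depth F x) \<otimes>\<^bsub>integer_mod_group (2 ^ depth F x)\<^esub> a x"

definition shift_act :: "'a forest \<Rightarrow> (nat \<Rightarrow> int) \<Rightarrow> ('a \<Rightarrow> complex) \<Rightarrow> 'a \<Rightarrow> complex" where
  "shift_act F h w = mult_form F (shift_act_additive F h (additive_form F w))"


section \<open>Projective space\<close>

text \<open>Homogeneous coordinates \<open>(v 0 : \<dots> : v n)\<close> are functions on \<^typ>\<open>nat\<close> vanishing
  beyond \<open>n\<close>.\<close>

definition proj_coords :: "nat \<Rightarrow> (nat \<Rightarrow> complex) set" where
  "proj_coords n = {v. (\<forall>i>n. v i = 0) \<and> (\<exists>i\<le>n. v i \<noteq> 0)}"

definition proj_rel :: "nat \<Rightarrow> ((nat \<Rightarrow> complex) \<times> (nat \<Rightarrow> complex)) set" where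
  "proj_rel n = {(u, v). u \<in> proj_coords n \<and> v \<in> proj_coords n \<and>
     (\<exists>s. s \<noteq> 0 \<and> v = (\<lambda>i. s * u i))}"

definition proj_space :: "nat \<Rightarrow> (nat \<Rightarrow> complex) set set" where
  "proj_space n = proj_coords n // proj_rel n"

definition proj_point :: "nat \<Rightarrow> (nat \<Rightarrow> complex) \<Rightarrow> (nat \<Rightarrow> complex) set" where
  "proj_point n v = proj_rel n `` {v}"


section \<open>Polynomials in the variables \<open>c\<^sub>\<alpha>\<close>, and the map \<open>\<phi>\<close>\<close>

type_synonym cpoly = "(nat \<Rightarrow>\<^sub>0 nat) \<Rightarrow>\<^sub>0 complex"

definition cconst :: "complex \<Rightarrow> cpoly" where
  "cconst a = Poly_Mapping.single 0 a"

definition cvar :: "nat \<Rightarrow> cpoly" where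
  "cvar \<alpha> = Poly_Mapping.single (Poly_Mapping.single \<alpha> 1) 1"

text \<open>Evaluation at \<open>(c, c')\<close> of the homogenization of \<open>p\<close>, separately in each pair
  \<open>(c\<^sub>\<alpha>, c'\<^sub>\<alpha>)\<close> to degree \<open>D\<^sub>\<alpha>\<close>, for \<open>\<alpha> \<in> J\<close>.\<close>

definition hom_value ::
  "nat set \<Rightarrow> (nat \<Rightarrow> nat) \<Rightarrow> (nat \<Rightarrow> complex) \<Rightarrow> (nat \<Rightarrow> complex) \<Rightarrow> cpoly \<Rightarrow> complex" where
  "hom_value J D c c' p =
     (\<Sum>\<mu>\<in>Poly_Mapping.keys p. Poly_Mapping.lookup p \<mu> *
        (\<Prod>\<alpha>\<in>J. c \<alpha> ^ Poly_Mapping.lookup \<mu> \<alpha> * c' \<alpha> ^ (D \<alpha> - Poly_Mapping.lookup \<mu> \<alpha>)))"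

definition frakP :: "'a forest \<Rightarrow> ('a \<Rightarrow> complex) \<Rightarrow> cpoly poly" where
  "frakP F w =
     (let e = (\<lambda>u. tree_depth (tree F (tree_index F u)) - depth F u) in
      (\<Prod>u\<in>final_nodes F.
         monom 1 2 - [:cconst (w u) * cvar (tree_index F u) ^ (2 ^ e u):]) *
      (\<Prod>u\<in>forest_nodes F - final_nodes F - ramification_nodes F.
         monom 1 1 + [:cconst (w (only_child F u)) * cvar (tree_index F u) ^ (2 ^ (e u - 1)):]))"

definition ambient_dim :: "'a forest \<Rightarrow> nat" where
  "ambient_dim F = card (forest_nodes F) + num_trees F"

definition max_degree :: "'a forest \<Rightarrow> ('a \<Rightarrow> complex) \<Rightarrow> nat \<Rightarrow> nat" where
  "max_degree F w \<alpha> =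
     Max (\<Union>\<kappa>\<in>{0..ambient_dim F}.
            (\<lambda>\<mu>. Poly_Mapping.lookup \<mu> \<alpha>) ` Poly_Mapping.keys (coeff (frakP F w) \<kappa>))"

definition phi_coords :: "'a forest \<Rightarrow> ('a \<Rightarrow> complex) \<Rightarrow> (nat \<Rightarrow> nat \<Rightarrow> complex) \<Rightarrow> nat \<Rightarrow> complex" where
  "phi_coords F w v \<kappa> =
     (if \<kappa> \<le> ambient_dim F
      then hom_value {1..num_trees F} (max_degree F w) (\<lambda>\<alpha>. v \<alpha> 0) (\<lambda>\<alpha>. v \<alpha> 1) (coeff (frakP F w) \<kappa>)
      else 0)"

text \<open>The source \<open>(\<bbbP>\<^sup>1)\<^sup>j\<close>; the coordinates \<open>(c\<^sub>\<alpha> : c'\<^sub>\<alpha>)\<close> of the factor \<open>\<alpha>\<close> are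
  \<open>v \<alpha> 0\<close> and \<open>v \<alpha> 1\<close>.\<close>

definition P1_power :: "nat \<Rightarrow> (nat \<Rightarrow> (nat \<Rightarrow> complex) set) set" where
  "P1_power j = (\<Pi>\<^sub>E \<alpha>\<in>{1..j}. proj_space 1)"

text \<open>All choices \<open>v\<close> of homogeneous coordinates of \<open>p\<close> give the same point, which is
  their union; see \<open>phi_eq\<close> and \<open>phi_in_proj_space\<close> below.\<close>

definition phi :: "'a forest \<Rightarrow> ('a \<Rightarrow> complex) \<Rightarrow> (nat \<Rightarrow> (nat \<Rightarrow> complex) set) \<Rightarrow> (nat \<Rightarrow> complex) set" where
  "phi F w p = (\<Union>v\<in>(\<Pi>\<^sub>E \<alpha>\<in>{1..num_trees F}. p \<alpha>). proj_point (ambient_dim F) (phi_coords F w v))"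


section \<open>Well-definedness of \<open>\<phi>\<close>\<close>

abbreviation mdeg :: "(nat \<Rightarrow>\<^sub>0 nat) \<Rightarrow> nat \<Rightarrow> nat" where
  "mdeg \<equiv> Poly_Mapping.lookup"

definition deg_bounded :: "nat set \<Rightarrow> (nat \<Rightarrow> nat) \<Rightarrow> cpoly \<Rightarrow> bool" where
  "deg_bounded J D p \<longleftrightarrow> (\<forall>\<mu>\<in>Poly_Mapping.keys p. \<forall>\<alpha>\<in>J. mdeg \<mu> \<alpha> \<le> D \<alpha>)"

lemma hom_value_0 [simp]: "hom_value J D c c' 0 = 0"
  by (simp add: hom_value_def)

lemma hom_value_add: "hom_value J D c c' (p + q) = hom_value J D c c' p + hom_value J D c c' q"
  unfolding hom_value_def
  using setsum_keys_plus_distrib[where p = p and q = q and f = "\<lambda>\<mu> a. a *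
        (\<Prod>\<alpha>\<in>J. c \<alpha> ^ mdeg \<mu> \<alpha> * c' \<alpha> ^ (D \<alpha> - mdeg \<mu> \<alpha>))"]
  by (simp add: distrib_right)

lemma hom_value_sum: "hom_value J D c c' (sum f A) = (\<Sum>x\<in>A. hom_value J D c c' (f x))"
  by (induction A rule: infinite_finite_induct) (auto simp: hom_value_add)

lemma hom_value_single:
  "hom_value J D c c' (Poly_Mapping.single \<mu> a) =
     a * (\<Prod>\<alpha>\<in>J. c \<alpha> ^ mdeg \<mu> \<alpha> * c' \<alpha> ^ (D \<alpha> - mdeg \<mu> \<alpha>))"
  by (cases "a = 0") (auto simp: hom_value_def)

lemma poly_mapping_as_sum:
  "p = (\<Sum>\<mu>\<in>Poly_Mapping.keys p. Poly_Mapping.single \<mu> (Poly_Mapping.lookup p \<mu>))"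
  by (rule poly_mapping_eqI)
     (simp add: lookup_sum lookup_single when_def in_keys_iff sum.delta)

lemma hom_value_mult:
  assumes "deg_bounded J D p" "deg_bounded J E q"
  shows "hom_value J (\<lambda>\<alpha>. D \<alpha> + E \<alpha>) c c' (p * q) = hom_value J D c c' p * hom_value J E c c' q"
proof -
  let ?S = "\<lambda>p \<mu>. Poly_Mapping.single \<mu> (Poly_Mapping.lookup p \<mu>)"
  have "p * q = (\<Sum>\<mu>\<in>Poly_Mapping.keys p. \<Sum>\<nu>\<in>Poly_Mapping.keys q. ?S p \<mu> * ?S q \<nu>)"
    by (subst poly_mapping_as_sum[of p], subst poly_mapping_as_sum[of q], simp only: sum_product)
  also have "\<dots> = (\<Sum>\<mu>\<in>Poly_Mapping.keys p. \<Sum>\<nu>\<in>Poly_Mapping.keys q.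
      Poly_Mapping.single (\<mu> + \<nu>) (Poly_Mapping.lookup p \<mu> * Poly_Mapping.lookup q \<nu>))"
    by (simp add: mult_single)
  finally have "hom_value J (\<lambda>\<alpha>. D \<alpha> + E \<alpha>) c c' (p * q) =
    (\<Sum>\<mu>\<in>Poly_Mapping.keys p. \<Sum>\<nu>\<in>Poly_Mapping.keys q.
      Poly_Mapping.lookup p \<mu> * Poly_Mapping.lookup q \<nu> *
      (\<Prod>\<alpha>\<in>J. c \<alpha> ^ mdeg (\<mu> + \<nu>) \<alpha> * c' \<alpha> ^ (D \<alpha> + E \<alpha> - mdeg (\<mu> + \<nu>) \<alpha>)))"
    by (simp add: hom_value_sum hom_value_single)
  also have "\<dots> = hom_value J D c c' p * hom_value J E c c' q"
    unfolding hom_value_def sum_product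
  proof (intro sum.cong refl)
    fix \<mu> \<nu> assume *: "\<mu> \<in> Poly_Mapping.keys p" "\<nu> \<in> Poly_Mapping.keys q"
    have "c \<alpha> ^ mdeg (\<mu> + \<nu>) \<alpha> * c' \<alpha> ^ (D \<alpha> + E \<alpha> - mdeg (\<mu> + \<nu>) \<alpha>) =
        (c \<alpha> ^ mdeg \<mu> \<alpha> * c' \<alpha> ^ (D \<alpha> - mdeg \<mu> \<alpha>)) *
        (c \<alpha> ^ mdeg \<nu> \<alpha> * c' \<alpha> ^ (E \<alpha> - mdeg \<nu> \<alpha>))" if "\<alpha> \<in> J" for \<alpha>
    proof -
      have "mdeg \<mu> \<alpha> \<le> D \<alpha>" "mdeg \<nu> \<alpha> \<le> E \<alpha>"
        using assms * that by (auto simp: deg_bounded_def)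
      then have "D \<alpha> + E \<alpha> - mdeg (\<mu> + \<nu>) \<alpha> = (D \<alpha> - mdeg \<mu> \<alpha>) + (E \<alpha> - mdeg \<nu> \<alpha>)"
        by (simp add: lookup_add)
      then show ?thesis by (simp add: lookup_add power_add)
    qed
    then show "Poly_Mapping.lookup p \<mu> * Poly_Mapping.lookup q \<nu> *
      (\<Prod>\<alpha>\<in>J. c \<alpha> ^ mdeg (\<mu> + \<nu>) \<alpha> * c' \<alpha> ^ (D \<alpha> + E \<alpha> - mdeg (\<mu> + \<nu>) \<alpha>)) =
      Poly_Mapping.lookup p \<mu> * (\<Prod>\<alpha>\<in>J. c \<alpha> ^ mdeg \<mu> \<alpha> * c' \<alpha> ^ (D \<alpha> - mdeg \<mu> \<alpha>)) *
      (Poly_Mapping.lookup q \<nu> * (\<Prod>\<alpha>\<in>J. c \<alpha> ^ mdeg \<nu> \<alpha> * c' \<alpha> ^ (E \<alpha> - mdeg \<nu> \<alpha>)))"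
      by (simp add: prod.distrib mult_ac)
  qed
  finally show ?thesis .
qed

lemma deg_bounded_add: "deg_bounded J D p \<Longrightarrow> deg_bounded J D q \<Longrightarrow> deg_bounded J D (p + q)"
  using keys_add[of p q] by (auto simp: deg_bounded_def)

lemma deg_bounded_0 [simp]: "deg_bounded J D 0"
  by (simp add: deg_bounded_def)

lemma deg_bounded_sum: "(\<And>x. x \<in> A \<Longrightarrow> deg_bounded J D (f x)) \<Longrightarrow> deg_bounded J D (sum f A)"
  by (induction A rule: infinite_finite_induct) (auto intro: deg_bounded_add)

lemma deg_bounded_mult:
  assumes "deg_bounded J D p" "deg_bounded J E q"
  shows "deg_bounded J (\<lambda>\<alpha>. D \<alpha> + E \<alpha>) (p * q)"
  unfolding deg_bounded_def
proof (intro ballI)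
  fix \<mu> \<alpha> assume "\<mu> \<in> Poly_Mapping.keys (p * q)" "\<alpha> \<in> J"
  then obtain a b where "\<mu> = a + b" "a \<in> Poly_Mapping.keys p" "b \<in> Poly_Mapping.keys q"
    using keys_mult[of p q] by blast
  then show "mdeg \<mu> \<alpha> \<le> D \<alpha> + E \<alpha>"
    using assms \<open>\<alpha> \<in> J\<close> by (auto simp: deg_bounded_def lookup_add intro: add_mono)
qed

definition hom_poly ::
  "nat set \<Rightarrow> (nat \<Rightarrow> nat) \<Rightarrow> (nat \<Rightarrow> complex) \<Rightarrow> (nat \<Rightarrow> complex) \<Rightarrow> cpoly poly \<Rightarrow> complex poly" where
  "hom_poly J D c c' = map_poly (hom_value J D c c')"

lemma coeff_hom_poly [simp]: "coeff (hom_poly J D c c' P) n = hom_value J D c c' (coeff P n)"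
  by (simp add: hom_poly_def coeff_map_poly)

definition poly_bounded :: "nat set \<Rightarrow> (nat \<Rightarrow> nat) \<Rightarrow> cpoly poly \<Rightarrow> bool" where
  "poly_bounded J D P \<longleftrightarrow> (\<forall>n. deg_bounded J D (coeff P n))"

lemma hom_poly_mult:
  assumes "poly_bounded J D P" "poly_bounded J E Q"
  shows "hom_poly J (\<lambda>\<alpha>. D \<alpha> + E \<alpha>) c c' (P * Q) = hom_poly J D c c' P * hom_poly J E c c' Q"
  using assms by (intro poly_eqI) (simp add: coeff_mult hom_value_sum hom_value_mult poly_bounded_def)

lemma poly_bounded_mult:
  assumes "poly_bounded J D P" "poly_bounded J E Q"
  shows "poly_bounded J (\<lambda>\<alpha>. D \<alpha> + E \<alpha>) (P * Q)"
  using assms by (auto simp: coeff_mult poly_bounded_def intro!: deg_bounded_sum deg_bounded_mult)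

lemma hom_value_1: "hom_value J (\<lambda>_. 0) c c' 1 = 1"
  by (simp add: hom_value_def)

lemma poly_bounded_1: "poly_bounded J (\<lambda>_. 0) 1"
  by (auto simp: poly_bounded_def coeff_1 deg_bounded_def)

lemma hom_poly_prod:
  assumes "finite A" "\<And>u. u \<in> A \<Longrightarrow> poly_bounded J (D u) (P u)"
  shows "poly_bounded J (\<lambda>\<alpha>. \<Sum>u\<in>A. D u \<alpha>) (\<Prod>u\<in>A. P u) \<and>
    hom_poly J (\<lambda>\<alpha>. \<Sum>u\<in>A. D u \<alpha>) c c' (\<Prod>u\<in>A. P u) = (\<Prod>u\<in>A. hom_poly J (D u) c c' (P u))"
  using assms
proof (induction A rule: finite_induct)
  case empty
  have "hom_poly J (\<lambda>_. 0) c c' 1 = 1"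
    by (rule poly_eqI) (auto simp: coeff_1 hom_value_1)
  then show ?case by (simp add: poly_bounded_1)
next
  case (insert u A)
  then show ?case
    using poly_bounded_mult[of J "D u" "P u" "\<lambda>\<alpha>. \<Sum>u\<in>A. D u \<alpha>" "\<Prod>u\<in>A. P u"]
      hom_poly_mult[of J "D u" "P u" "\<lambda>\<alpha>. \<Sum>u\<in>A. D u \<alpha>" "\<Prod>u\<in>A. P u"]
    by simp
qed

lemma cvar_power: "cvar \<alpha> ^ e = Poly_Mapping.single (Poly_Mapping.single \<alpha> e) 1"
  by (induction e) (auto simp: cvar_def mult_single simp flip: single_add)

lemma cconst_cvar: "cconst a * cvar \<alpha> ^ e = Poly_Mapping.single (Poly_Mapping.single \<alpha> e) a"
  by (simp add: cvar_power cconst_def mult_single)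

lemma hom_value_monomial:
  assumes "finite J" "\<beta> \<in> J"
  shows "hom_value J (\<lambda>\<alpha>. if \<alpha> = \<beta> then e else 0) c c' (cconst a * cvar \<beta> ^ e) = a * c \<beta> ^ e"
proof -
  have "(\<Prod>\<alpha>\<in>J. c \<alpha> ^ mdeg (Poly_Mapping.single \<beta> e) \<alpha> *
      c' \<alpha> ^ ((if \<alpha> = \<beta> then e else 0) - mdeg (Poly_Mapping.single \<beta> e) \<alpha>)) =
      (\<Prod>\<alpha>\<in>J. if \<alpha> = \<beta> then c \<beta> ^ e else 1)"
    by (rule prod.cong) (auto simp: lookup_single when_def)
  then show ?thesis
    using assms by (simp add: cconst_cvar hom_value_single prod.delta)
qed

lemma hom_value_one:
  assumes "finite J" "\<beta> \<in> J"
  shows "hom_value J (\<lambda>\<alpha>. if \<alpha> = \<beta> then e else 0) c c' 1 = c' \<beta> ^ e"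
proof -
  have "(\<Prod>\<alpha>\<in>J. c \<alpha> ^ mdeg 0 \<alpha> * c' \<alpha> ^ ((if \<alpha> = \<beta> then e else 0) - mdeg 0 \<alpha>)) =
      (\<Prod>\<alpha>\<in>J. if \<alpha> = \<beta> then c' \<beta> ^ e else 1)"
    by (rule prod.cong) auto
  then show ?thesis
    using assms hom_value_single[of J _ c c' 0 1] by (simp add: prod.delta)
qed

lemma cconst_minus: "cconst (- a) = - cconst a"
  by (simp add: cconst_def single_uminus)

text \<open>Both kinds of factors of \<open>frakP\<close> have the shape \<open>Y\<^sup>n + a c\<^sub>\<beta>\<^sup>e\<close>.\<close>

definition factor :: "nat \<Rightarrow> complex \<Rightarrow> nat \<Rightarrow> nat \<Rightarrow> cpoly poly" where
  "factor n a \<beta> e = monom 1 n + [:cconst a * cvar \<beta> ^ e:]"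

lemma deg_bounded_monomial: "deg_bounded J (\<lambda>\<alpha>. if \<alpha> = \<beta> then e else 0) (cconst a * cvar \<beta> ^ e)"
  by (auto simp: cconst_cvar deg_bounded_def lookup_single when_def split: if_splits)

lemma poly_bounded_factor: "poly_bounded J (\<lambda>\<alpha>. if \<alpha> = \<beta> then e else 0) (factor n a \<beta> e)"
  unfolding poly_bounded_def factor_def
proof
  fix k
  have "deg_bounded J (\<lambda>\<alpha>. if \<alpha> = \<beta> then e else 0) 1"
    by (auto simp: deg_bounded_def)
  then show "deg_bounded J (\<lambda>\<alpha>. if \<alpha> = \<beta> then e else 0)
      (coeff (monom 1 n + [:cconst a * cvar \<beta> ^ e:]) k)"
    by (auto simp: coeff_pCons intro!: deg_bounded_add deg_bounded_monomial split: nat.split)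
qed

lemma hom_poly_factor:
  assumes "finite J" "\<beta> \<in> J"
  shows "hom_poly J (\<lambda>\<alpha>. if \<alpha> = \<beta> then e else 0) c c' (factor n a \<beta> e) =
     monom (c' \<beta> ^ e) n + [:a * c \<beta> ^ e:]"
  using assms
  by (intro poly_eqI)
     (auto simp: factor_def coeff_pCons hom_value_add hom_value_one hom_value_monomial split: nat.split)

lemma degree_factor:
  "degree (monom 1 n + [:b:] :: 'b::comm_semiring_1 poly) = n" if "n > 0"
  using that by (subst degree_add_eq_left) (auto simp: degree_monom_eq)

lemma hom_factor_nonzero:
  assumes "n > 0" "a \<noteq> 0" "x \<noteq> 0 \<or> y \<noteq> (0::complex)"
  shows "monom (y ^ e) n + [:a * x ^ e:] \<noteq> 0"
proof
  assume "monom (y ^ e) n + [:a * x ^ e:] = 0"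
  then have "coeff (monom (y ^ e) n + [:a * x ^ e:]) n = 0"
    "coeff (monom (y ^ e) n + [:a * x ^ e:]) 0 = 0" by simp_all
  then have "y ^ e = 0" "a * x ^ e = 0"
    using assms(1) by (auto simp: coeff_pCons split: nat.splits)
  then show False using assms by (auto simp: power_0_left split: if_splits)
qed

lemma tree_index_eq:
  assumes "is_forest F" "\<alpha> \<in> {1..num_trees F}" "x \<in> node_set (tree F \<alpha>)"
  shows "tree_index F x = \<alpha>"
  unfolding tree_index_def
proof (rule the_equality)
  fix \<beta> assume "\<beta> \<in> {1..num_trees F} \<and> x \<in> node_set (tree F \<beta>)"
  then show "\<beta> = \<alpha>"
    using assms unfolding is_forest_def disjoint_family_on_def by blast
qed (use assms in auto)

lemma tree_index_in:
  assumes "is_forest F" "x \<in> forest_nodes F"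
  shows "tree_index F x \<in> {1..num_trees F}" "x \<in> node_set (tree F (tree_index F x))"
  using assms tree_index_eq[OF assms(1)] by (auto simp: forest_nodes_def)

lemma finite_forest_nodes: "is_forest F \<Longrightarrow> finite (forest_nodes F)"
  by (auto simp: forest_nodes_def is_forest_def is_tree_def)

lemma edge_in_tree:
  assumes "is_forest F" "\<alpha> \<in> {1..num_trees F}" "x \<in> node_set (tree F \<alpha>) \<or> y \<in> node_set (tree F \<alpha>)"
  shows "(x, y) \<in> forest_edges F \<longleftrightarrow> (x, y) \<in> edge_set (tree F \<alpha>)"
proof
  assume "(x, y) \<in> forest_edges F"
  then obtain \<beta> where \<beta>: "\<beta> \<in> {1..num_trees F}" "(x, y) \<in> edge_set (tree F \<beta>)"
    by (auto simp: forest_edges_def)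
  then have "x \<in> node_set (tree F \<beta>)" "y \<in> node_set (tree F \<beta>)"
    using assms(1) by (auto simp: is_forest_def is_tree_def)
  then have "\<beta> = \<alpha>"
    using assms \<beta>(1) tree_index_eq[OF assms(1)] by metis
  then show "(x, y) \<in> edge_set (tree F \<alpha>)" using \<beta> by simp
qed (use assms in \<open>auto simp: forest_edges_def\<close>)

lemma children_tree:
  assumes "is_forest F" "\<alpha> \<in> {1..num_trees F}" "x \<in> node_set (tree F \<alpha>)"
  shows "children F x = {y. (x, y) \<in> edge_set (tree F \<alpha>)}"
  using edge_in_tree[OF assms(1,2)] assms(3) by (auto simp: children_def)

lemma children_props:
  assumes "is_forest F" "x \<in> forest_nodes F"
  shows "children F x \<subseteq> forest_nodes F" "finite (children F x)" "card (children F x) \<le> 2"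
proof -
  obtain \<alpha> where \<alpha>: "\<alpha> \<in> {1..num_trees F}" "x \<in> node_set (tree F \<alpha>)"
    using assms by (auto simp: forest_nodes_def)
  note c = children_tree[OF assms(1) \<alpha>]
  have t: "is_tree (tree F \<alpha>)" using assms \<alpha> by (auto simp: is_forest_def)
  then show "card (children F x) \<le> 2" using \<alpha> c by (auto simp: is_tree_def)
  show "children F x \<subseteq> forest_nodes F"
    using t \<alpha> unfolding c forest_nodes_def is_tree_def by blast
  then show "finite (children F x)"
    using finite_forest_nodes[OF assms(1)] finite_subset by blast
qed

abbreviation unary_nodes :: "'a forest \<Rightarrow> 'a set" where
  "unary_nodes F \<equiv> forest_nodes F - final_nodes F - ramification_nodes F"

lemma card_children_unary:
  assumes "is_forest F" "u \<in> unary_nodes F"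
  shows "card (children F u) = 1"
proof -
  have "card (children F u) \<noteq> 0"
    using assms children_props[OF assms(1)] by (auto simp: final_nodes_def)
  moreover have "card (children F u) \<noteq> 2" "card (children F u) \<le> 2"
    using assms children_props[OF assms(1)] by (auto simp: ramification_nodes_def)
  ultimately show ?thesis by linarith
qed

lemma only_child_in:
  assumes "is_forest F" "u \<in> unary_nodes F"
  shows "only_child F u \<in> children F u"
proof -
  obtain y where "children F u = {y}"
    using card_children_unary[OF assms] by (meson card_1_singletonE)
  then show ?thesis by (simp add: only_child_def)
qed

lemma parent_unique:
  assumes "is_forest F" "y \<in> children F x" "y \<in> children F x'"
  shows "x = x'"
proof -
  obtain \<alpha> where \<alpha>: "\<alpha> \<in> {1..num_trees F}" "(x, y) \<in> edge_set (tree F \<alpha>)"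
    using assms by (auto simp: children_def forest_edges_def)
  have t: "is_tree (tree F \<alpha>)" using assms \<alpha> by (auto simp: is_forest_def)
  then have y: "y \<in> node_set (tree F \<alpha>)" using \<alpha> by (auto simp: is_tree_def)
  then have "(x', y) \<in> edge_set (tree F \<alpha>)"
    using edge_in_tree[OF assms(1) \<alpha>(1)] assms(3) by (auto simp: children_def)
  then show ?thesis
    using t y \<alpha>(2) unfolding is_tree_def by (metis DiffI singletonD)
qed

lemma children_cover:
  assumes "is_forest F"
  shows "(\<Union>x\<in>forest_nodes F. children F x) = forest_nodes F - forest_roots F"
proof (intro equalityI subsetI)
  fix y assume "y \<in> (\<Union>x\<in>forest_nodes F. children F x)"
  then obtain x where x: "x \<in> forest_nodes F" "y \<in> children F x" by blast
  have "y \<notin> forest_roots F"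
  proof
    assume "y \<in> forest_roots F"
    then obtain \<alpha> where \<alpha>: "\<alpha> \<in> {1..num_trees F}" "y = root_node (tree F \<alpha>)"
      by (auto simp: forest_roots_def)
    have t: "is_tree (tree F \<alpha>)" using assms \<alpha> by (auto simp: is_forest_def)
    have "(x, y) \<in> edge_set (tree F \<alpha>)"
      using edge_in_tree[OF assms \<alpha>(1), of x y] x(2) \<alpha> t by (auto simp: children_def is_tree_def)
    then show False using t \<alpha> by (auto simp: is_tree_def)
  qed
  then show "y \<in> forest_nodes F - forest_roots F"
    using children_props(1)[OF assms x(1)] x by blast
next
  fix y assume y: "y \<in> forest_nodes F - forest_roots F"
  then obtain \<alpha> where \<alpha>: "\<alpha> \<in> {1..num_trees F}" "y \<in> node_set (tree F \<alpha>)"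
    by (auto simp: forest_nodes_def)
  have t: "is_tree (tree F \<alpha>)" using assms \<alpha> by (auto simp: is_forest_def)
  have "y \<noteq> root_node (tree F \<alpha>)" using y \<alpha> by (auto simp: forest_roots_def)
  then obtain x where x: "(x, y) \<in> edge_set (tree F \<alpha>)"
    using t \<alpha> unfolding is_tree_def by blast
  then have "x \<in> node_set (tree F \<alpha>)" using t by (auto simp: is_tree_def)
  then show "y \<in> (\<Union>x\<in>forest_nodes F. children F x)"
    using x \<alpha> unfolding children_def forest_nodes_def forest_edges_def by blast
qed

lemma forest_roots_props:
  assumes "is_forest F"
  shows "forest_roots F \<subseteq> forest_nodes F" "card (forest_roots F) = num_trees F"
proof -
  have r: "root_node (tree F \<alpha>) \<in> node_set (tree F \<alpha>)" if "\<alpha> \<in> {1..num_trees F}" for \<alpha>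
    using assms that by (auto simp: is_forest_def is_tree_def)
  then show "forest_roots F \<subseteq> forest_nodes F"
    by (auto simp: forest_roots_def forest_nodes_def)
  have "inj_on (\<lambda>\<alpha>. root_node (tree F \<alpha>)) {1..num_trees F}"
    by (rule inj_onI) (metis r assms tree_index_eq)
  then show "card (forest_roots F) = num_trees F"
    by (simp add: forest_roots_def card_image)
qed

lemma ambient_dim_eq:
  assumes "is_forest F"
  shows "2 * card (final_nodes F) + card (unary_nodes F) = ambient_dim F"
proof -
  let ?N = "forest_nodes F"
  have fin: "finite ?N" by (rule finite_forest_nodes[OF assms])
  have sub: "final_nodes F \<subseteq> ?N" "ramification_nodes F \<subseteq> ?N" "final_nodes F \<inter> ramification_nodes F = {}"
    by (auto simp: final_nodes_def ramification_nodes_def)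
  have N: "?N = (final_nodes F \<union> ramification_nodes F) \<union> unary_nodes F"
    using sub by blast
  have fins: "finite (final_nodes F)" "finite (ramification_nodes F)" "finite (unary_nodes F)"
    using sub fin finite_subset by auto
  have split: "(\<Sum>x\<in>?N. f x) = (\<Sum>x\<in>final_nodes F. f x) + (\<Sum>x\<in>ramification_nodes F. f x)
      + (\<Sum>x\<in>unary_nodes F. f x)" for f :: "'a \<Rightarrow> nat"
  proof -
    have "sum f ?N = sum f (final_nodes F \<union> ramification_nodes F) + sum f (unary_nodes F)"
      by (subst N, subst sum.union_disjoint) (use fins in auto)
    then show ?thesis
      using fins sub by (simp add: sum.union_disjoint)
  qed
  have "(\<Sum>x\<in>?N. card (children F x)) = card (\<Union>x\<in>?N. children F x)"
    using fin children_props[OF assms] parent_unique[OF assms]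
    by (subst card_UN_disjoint) auto
  also have "\<dots> = card ?N - num_trees F"
    using forest_roots_props[OF assms] fin
    by (simp add: children_cover[OF assms] card_Diff_subset finite_subset)
  finally have 1: "(\<Sum>x\<in>?N. card (children F x)) = card ?N - num_trees F" .
  have "(\<Sum>x\<in>final_nodes F. card (children F x)) = 0"
    by (auto simp: final_nodes_def)
  moreover have "(\<Sum>x\<in>ramification_nodes F. card (children F x)) = 2 * card (ramification_nodes F)"
    by (simp add: ramification_nodes_def)
  moreover have "(\<Sum>x\<in>unary_nodes F. card (children F x)) = card (unary_nodes F)"
    using card_children_unary[OF assms] by simp
  ultimately have 2: "2 * card (ramification_nodes F) + card (unary_nodes F) = card ?N - num_trees F"
    using 1 split[of "\<lambda>x. card (children F x)"] by simp
  have 3: "card ?N = card (final_nodes F) + card (ramification_nodes F) + card (unary_nodes F)"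
    using split[of "\<lambda>_. 1"] by simp
  have "num_trees F \<le> card ?N"
    using forest_roots_props[OF assms] fin by (metis card_mono)
  then show ?thesis using 2 3 by (simp add: ambient_dim_def)
qed

lemma weight_nonzero:
  assumes "is_forest F" "is_weight F w" "x \<in> forest_nodes F"
  shows "w x \<noteq> 0"
proof -
  have "is_tree_weight (tree F (tree_index F x)) w" "x \<in> node_set (tree F (tree_index F x))"
    using assms tree_index_in[OF assms(1,3)] by (auto simp: is_weight_def)
  then have "w x ^ (2 ^ tree_depth (tree F (tree_index F x))) = 1"
    by (auto simp: is_tree_weight_def)
  then show ?thesis by (auto simp: power_0_left)
qed

lemma weight_power_depth:
  assumes "is_forest F" "is_weight F w" "x \<in> forest_nodes F"
  shows "w x ^ (2 ^ depth F x) = 1"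
proof -
  let ?T = "tree F (tree_index F x)"
  have T: "is_tree ?T" "is_tree_weight ?T w" "x \<in> node_set ?T"
    using assms tree_index_in[OF assms(1,3)] by (auto simp: is_weight_def is_forest_def)
  have step: "w y ^ (2 ^ n) = 1" if "(root_node ?T, y) \<in> edge_set ?T ^^ n" for n y
    using that
  proof (induction n arbitrary: y)
    case 0
    then show ?case using T by (auto simp: is_tree_weight_def)
  next
    case (Suc n)
    then obtain z where z: "(root_node ?T, z) \<in> edge_set ?T ^^ n" "(z, y) \<in> edge_set ?T"
      by auto
    have "w y ^ (2 ^ Suc n) = ((w y)\<^sup>2) ^ (2 ^ n)"
      by (simp flip: power_mult)
    also have "\<dots> = w z ^ (2 ^ n)"
      using T(2) z(2) by (auto simp: is_tree_weight_def)
    finally show ?case using Suc.IH[OF z(1)] by simp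
  qed
  obtain n where "(root_node ?T, x) \<in> edge_set ?T ^^ n"
    using T unfolding is_tree_def by (metis rtrancl_imp_relpow)
  then have "(root_node ?T, x) \<in> edge_set ?T ^^ (depth F x)"
    unfolding depth_def node_depth_def by (rule LeastI)
  then show ?thesis by (rule step)
qed

lemma additive_form:
  assumes "is_forest F" "is_weight F w" "x \<in> forest_nodes F"
  shows "additive_form F w x \<in> carrier (integer_mod_group (2 ^ depth F x))"
    and "mult_form F (additive_form F w) x = w x"
proof -
  let ?n = "2 ^ depth F x :: nat"
  let ?P = "\<lambda>a. a \<in> carrier (integer_mod_group ?n) \<and>
             w x = exp (2 * pi * \<i> * of_int a / 2 ^ depth F x)"
  have "w x \<in> {z. z ^ ?n = 1}"
    using weight_power_depth[OF assms] by simp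
  also have "\<dots> = {exp (2 * of_real pi * \<i> * of_nat k / of_nat ?n) | k. k < ?n}"
    by (rule complex_roots_unity) simp
  finally obtain k where k: "k < ?n" "w x = exp (2 * of_real pi * \<i> * of_nat k / of_nat ?n)"
    by blast
  have "?P (int k)"
    using k by (simp add: carrier_integer_mod_group)
  moreover have "b = int k" if b: "?P b" for b
  proof -
    have b': "b = int (nat b)" "nat b < ?n"
      using b by (auto simp: carrier_integer_mod_group nat_less_iff)
    have "exp (2 * of_real pi * \<i> * of_nat (nat b) / of_nat ?n) =
        exp (2 * of_real pi * \<i> * of_nat k / of_nat ?n)"
    proof -
      have "of_nat (nat b) = (of_int b :: complex)" using b'(1) by (metis of_int_of_nat_eq)
      then show ?thesis using b k(2) by simp
    qed
    then have "nat b mod ?n = k mod ?n"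
      by (subst (asm) complex_root_unity_eq) (auto simp: cong_def)
    then have "nat b = k" using b' k(1) by simp
    then show ?thesis using b'(1) by simp
  qed
  ultimately have "?P (additive_form F w x)"
    unfolding additive_form_def by (rule theI)
  then show "additive_form F w x \<in> carrier (integer_mod_group ?n)"
    "mult_form F (additive_form F w) x = w x"
    by (simp_all add: mult_form_def)
qed

definition factor_exp :: "'a forest \<Rightarrow> 'a \<Rightarrow> nat" where
  "factor_exp F u =
     (let e = tree_depth (tree F (tree_index F u)) - depth F u
      in if u \<in> final_nodes F then 2 ^ e else 2 ^ (e - 1))"

definition factor_poly :: "'a forest \<Rightarrow> ('a \<Rightarrow> complex) \<Rightarrow> 'a \<Rightarrow> cpoly poly" where
  "factor_poly F w u =
     (if u \<in> final_nodes F then factor 2 (- w u) (tree_index F u) (factor_exp F u)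
      else factor 1 (w (only_child F u)) (tree_index F u) (factor_exp F u))"

lemma frakP_factors:
  assumes "is_forest F"
  shows "frakP F w = (\<Prod>u\<in>final_nodes F \<union> unary_nodes F. factor_poly F w u)"
proof -
  have fin: "finite (final_nodes F)" "finite (unary_nodes F)"
    using finite_forest_nodes[OF assms] by (auto simp: final_nodes_def)
  have "frakP F w = (\<Prod>u\<in>final_nodes F. factor_poly F w u) * (\<Prod>u\<in>unary_nodes F. factor_poly F w u)"
    unfolding frakP_def Let_def
    by (intro arg_cong2[where f = times] prod.cong refl)
       (auto simp: factor_poly_def factor_def factor_exp_def Let_def cconst_minus)
  also have "\<dots> = (\<Prod>u\<in>final_nodes F \<union> unary_nodes F. factor_poly F w u)"
    by (rule prod.union_disjoint[symmetric]) (use fin in auto)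
  finally show ?thesis .
qed

lemma degree_frakP:
  assumes "is_forest F"
  shows "degree (frakP F w) = ambient_dim F"
proof -
  let ?A = "final_nodes F \<union> unary_nodes F"
  have fin: "finite (final_nodes F)" "finite (unary_nodes F)"
    using finite_forest_nodes[OF assms] by (auto simp: final_nodes_def)
  have d: "degree (factor_poly F w u) = (if u \<in> final_nodes F then 2 else 1)" for u
    by (simp add: factor_poly_def factor_def degree_factor)
  have "factor_poly F w u \<noteq> 0" for u
    using d[of u] by (metis degree_0 one_neq_zero zero_neq_numeral)
  then have "degree (frakP F w) = (\<Sum>u\<in>?A. degree (factor_poly F w u))"
    unfolding frakP_factors[OF assms] by (intro degree_prod_eq_sum_degree) auto
  also have "\<dots> = (\<Sum>u\<in>final_nodes F. degree (factor_poly F w u)) + (\<Sum>u\<in>unary_nodes F. degree (factor_poly F w u))"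
    by (rule sum.union_disjoint) (use fin in auto)
  also have "(\<Sum>u\<in>final_nodes F. degree (factor_poly F w u)) = 2 * card (final_nodes F)"
    by (simp add: d)
  also have "(\<Sum>u\<in>unary_nodes F. degree (factor_poly F w u)) = card (unary_nodes F)"
    by (simp add: d)
  finally show ?thesis using ambient_dim_eq[OF assms] by simp
qed

definition total_exp :: "'a forest \<Rightarrow> nat \<Rightarrow> nat" where
  "total_exp F \<alpha> =
     (\<Sum>u\<in>final_nodes F \<union> unary_nodes F. if \<alpha> = tree_index F u then factor_exp F u else 0)"

lemma frakP_bounded_nonzero:
  assumes F: "is_forest F" and w: "is_weight F w"
  shows "poly_bounded {1..num_trees F} (total_exp F) (frakP F w)"
    and "(\<And>\<alpha>. \<alpha> \<in> {1..num_trees F} \<Longrightarrow> c \<alpha> \<noteq> 0 \<or> c' \<alpha> \<noteq> 0) \<Longrightarrow>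
      hom_poly {1..num_trees F} (total_exp F) c c' (frakP F w) \<noteq> 0"
proof -
  let ?A = "final_nodes F \<union> unary_nodes F" and ?J = "{1..num_trees F}"
  let ?D = "\<lambda>u \<alpha>. if \<alpha> = tree_index F u then factor_exp F u else 0"
  have fin: "finite ?A"
    using finite_forest_nodes[OF F] by (auto simp: final_nodes_def)
  have idx: "tree_index F u \<in> ?J" if "u \<in> ?A" for u
    using that tree_index_in(1)[OF F] by (auto simp: final_nodes_def)
  have b: "poly_bounded ?J (?D u) (factor_poly F w u)" for u
    by (simp add: factor_poly_def poly_bounded_factor)
  have tot: "total_exp F = (\<lambda>\<alpha>. \<Sum>u\<in>?A. ?D u \<alpha>)"
    by (rule ext) (simp add: total_exp_def)
  show "poly_bounded ?J (total_exp F) (frakP F w)"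
    unfolding tot frakP_factors[OF F] using hom_poly_prod[where D = ?D and P = "factor_poly F w", OF fin b] by blast
  assume nz: "\<And>\<alpha>. \<alpha> \<in> ?J \<Longrightarrow> c \<alpha> \<noteq> 0 \<or> c' \<alpha> \<noteq> 0"
  have "hom_poly ?J (?D u) c c' (factor_poly F w u) \<noteq> 0" if u: "u \<in> ?A" for u
  proof (cases "u \<in> final_nodes F")
    case True
    then have "w u \<noteq> 0" using weight_nonzero[OF F w] by (auto simp: final_nodes_def)
    then have "monom (c' (tree_index F u) ^ factor_exp F u) 2 +
        [:- w u * c (tree_index F u) ^ factor_exp F u:] \<noteq> 0"
      using nz[OF idx[OF u]] by (intro hom_factor_nonzero) auto
    then show ?thesis
      using True idx[OF u] by (simp only: factor_poly_def if_True hom_poly_factor finite_atLeastAtMost) simp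
  next
    case False
    then have "only_child F u \<in> forest_nodes F"
      using u only_child_in[OF F, of u] children_props(1)[OF F, of u] by blast
    then have "w (only_child F u) \<noteq> 0" using weight_nonzero[OF F w] by auto
    then have "monom (c' (tree_index F u) ^ factor_exp F u) 1 +
        [:w (only_child F u) * c (tree_index F u) ^ factor_exp F u:] \<noteq> 0"
      using nz[OF idx[OF u]] by (intro hom_factor_nonzero) auto
    then show ?thesis
      using False idx[OF u] by (simp only: factor_poly_def if_False hom_poly_factor finite_atLeastAtMost) simp
  qed
  then show "hom_poly ?J (total_exp F) c c' (frakP F w) \<noteq> 0"
    unfolding tot frakP_factors[OF F] using hom_poly_prod[where D = ?D and P = "factor_poly F w", OF fin b] fin by simp
qed

lemma max_degree_eq:
  assumes F: "is_forest F" and w: "is_weight F w" and \<alpha>: "\<alpha> \<in> {1..num_trees F}"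
  shows "max_degree F w \<alpha> = total_exp F \<alpha>"
proof -
  let ?J = "{1..num_trees F}"
  let ?S = "\<Union>\<kappa>\<in>{0..ambient_dim F}.
            (\<lambda>\<mu>. mdeg \<mu> \<alpha>) ` Poly_Mapping.keys (coeff (frakP F w) \<kappa>)"
  have "finite ?S" by auto
  moreover have "x \<le> total_exp F \<alpha>" if "x \<in> ?S" for x
    using that frakP_bounded_nonzero(1)[OF F w] \<alpha> by (auto simp: poly_bounded_def deg_bounded_def)
  moreover have "total_exp F \<alpha> \<in> ?S"
  proof -
    let ?c = "\<lambda>_. 1 :: complex" and ?c' = "\<lambda>\<beta>. if \<beta> = \<alpha> then 0 else 1 :: complex"
    have "hom_poly ?J (total_exp F) ?c ?c' (frakP F w) \<noteq> 0"
      by (rule frakP_bounded_nonzero(2)[OF F w]) auto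
    then obtain \<kappa> where \<kappa>: "hom_value ?J (total_exp F) ?c ?c' (coeff (frakP F w) \<kappa>) \<noteq> 0"
      by (metis coeff_hom_poly leading_coeff_0_iff)
    then obtain \<mu> where \<mu>: "\<mu> \<in> Poly_Mapping.keys (coeff (frakP F w) \<kappa>)"
      "(\<Prod>\<beta>\<in>?J. ?c \<beta> ^ mdeg \<mu> \<beta> * ?c' \<beta> ^ (total_exp F \<beta> - mdeg \<mu> \<beta>)) \<noteq> 0"
      unfolding hom_value_def by (metis (no_types, lifting) mult_zero_right sum.neutral)
    have "?c \<alpha> ^ mdeg \<mu> \<alpha> * ?c' \<alpha> ^ (total_exp F \<alpha> - mdeg \<mu> \<alpha>) \<noteq> 0"
      using \<mu>(2) \<alpha> by (simp only: prod_zero_iff finite_atLeastAtMost) blast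
    then have "total_exp F \<alpha> \<le> mdeg \<mu> \<alpha>"
      by (simp add: power_0_left split: if_splits)
    moreover have "mdeg \<mu> \<alpha> \<le> total_exp F \<alpha>"
      using \<mu>(1) frakP_bounded_nonzero(1)[OF F w] \<alpha> by (auto simp: poly_bounded_def deg_bounded_def)
    moreover have "coeff (frakP F w) \<kappa> \<noteq> 0" using \<kappa> by auto
    then have "\<kappa> \<le> ambient_dim F"
      using le_degree degree_frakP[OF F] by metis
    ultimately show ?thesis using \<mu>(1) by force
  qed
  ultimately show ?thesis
    unfolding max_degree_def by (intro Max_eqI) auto
qed

lemma hom_value_cong:
  assumes "\<And>\<alpha>. \<alpha> \<in> J \<Longrightarrow> D \<alpha> = E \<alpha>"
  shows "hom_value J D c c' p = hom_value J E c c' p"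
  using assms by (simp add: hom_value_def)

lemma phi_coords_in:
  assumes F: "is_forest F" and w: "is_weight F w"
    and v: "\<And>\<alpha>. \<alpha> \<in> {1..num_trees F} \<Longrightarrow> v \<alpha> \<in> proj_coords 1"
  shows "phi_coords F w v \<in> proj_coords (ambient_dim F)"
proof -
  let ?J = "{1..num_trees F}"
  let ?H = "hom_poly ?J (total_exp F) (\<lambda>\<alpha>. v \<alpha> 0) (\<lambda>\<alpha>. v \<alpha> 1) (frakP F w)"
  have "?H \<noteq> 0"
  proof (rule frakP_bounded_nonzero(2)[OF F w])
    fix \<alpha> assume "\<alpha> \<in> ?J"
    from v[OF this] show "v \<alpha> 0 \<noteq> 0 \<or> v \<alpha> 1 \<noteq> 0"
      unfolding proj_coords_def by (auto simp: le_Suc_eq)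
  qed
  then obtain \<kappa> where \<kappa>: "coeff ?H \<kappa> \<noteq> 0"
    by (metis leading_coeff_0_iff)
  then have "coeff (frakP F w) \<kappa> \<noteq> 0" by auto
  then have "\<kappa> \<le> ambient_dim F"
    using le_degree degree_frakP[OF F] by metis
  moreover have "coeff ?H \<kappa> = hom_value ?J (max_degree F w) (\<lambda>\<alpha>. v \<alpha> 0) (\<lambda>\<alpha>. v \<alpha> 1) (coeff (frakP F w) \<kappa>)"
    unfolding coeff_hom_poly by (rule hom_value_cong) (simp add: max_degree_eq[OF F w])
  ultimately show ?thesis
    using \<kappa> by (auto simp: proj_coords_def phi_coords_def)
qed

lemma phi_coords_scale:
  assumes F: "is_forest F" and w: "is_weight F w"
    and v: "\<And>\<alpha>. \<alpha> \<in> {1..num_trees F} \<Longrightarrow> v' \<alpha> = (\<lambda>i. s \<alpha> * v \<alpha> i)"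
  shows "phi_coords F w v' =
    (\<lambda>\<kappa>. (\<Prod>\<alpha>\<in>{1..num_trees F}. s \<alpha> ^ max_degree F w \<alpha>) * phi_coords F w v \<kappa>)"
proof
  fix \<kappa>
  let ?J = "{1..num_trees F}" and ?D = "max_degree F w" and ?p = "coeff (frakP F w) \<kappa>"
  have *: "(\<Prod>\<alpha>\<in>?J. v' \<alpha> 0 ^ mdeg \<mu> \<alpha> * v' \<alpha> 1 ^ (?D \<alpha> - mdeg \<mu> \<alpha>)) =
      (\<Prod>\<alpha>\<in>?J. s \<alpha> ^ ?D \<alpha>) * (\<Prod>\<alpha>\<in>?J. v \<alpha> 0 ^ mdeg \<mu> \<alpha> * v \<alpha> 1 ^ (?D \<alpha> - mdeg \<mu> \<alpha>))"
    if \<mu>: "\<mu> \<in> Poly_Mapping.keys ?p" for \<mu>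
  proof -
    have "v' \<alpha> 0 ^ mdeg \<mu> \<alpha> * v' \<alpha> 1 ^ (?D \<alpha> - mdeg \<mu> \<alpha>) =
      s \<alpha> ^ ?D \<alpha> * (v \<alpha> 0 ^ mdeg \<mu> \<alpha> * v \<alpha> 1 ^ (?D \<alpha> - mdeg \<mu> \<alpha>))" if "\<alpha> \<in> ?J" for \<alpha>
    proof -
      have "mdeg \<mu> \<alpha> \<le> ?D \<alpha>"
        using frakP_bounded_nonzero(1)[OF F w] \<mu> that
        by (auto simp: max_degree_eq[OF F w] poly_bounded_def deg_bounded_def)
      then have "s \<alpha> ^ ?D \<alpha> = s \<alpha> ^ mdeg \<mu> \<alpha> * s \<alpha> ^ (?D \<alpha> - mdeg \<mu> \<alpha>)"
        by (simp flip: power_add)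
      then show ?thesis by (simp add: v[OF that] power_mult_distrib)
    qed
    then show ?thesis by (simp flip: prod.distrib)
  qed
  show "phi_coords F w v' \<kappa> = (\<Prod>\<alpha>\<in>?J. s \<alpha> ^ ?D \<alpha>) * phi_coords F w v \<kappa>"
  proof (cases "\<kappa> \<le> ambient_dim F")
    case True
    have "hom_value ?J ?D (\<lambda>\<alpha>. v' \<alpha> 0) (\<lambda>\<alpha>. v' \<alpha> 1) ?p =
        (\<Prod>\<alpha>\<in>?J. s \<alpha> ^ ?D \<alpha>) * hom_value ?J ?D (\<lambda>\<alpha>. v \<alpha> 0) (\<lambda>\<alpha>. v \<alpha> 1) ?p"
      unfolding hom_value_def sum_distrib_left
      by (rule sum.cong[OF refl], subst *, assumption) (simp only: mult_ac)
    then show ?thesis using True by (simp only: phi_coords_def if_True)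
  qed (simp add: phi_coords_def)
qed

lemma equiv_proj_rel: "equiv (proj_coords n) (proj_rel n)"
proof (rule equivI)
  show "proj_rel n \<subseteq> proj_coords n \<times> proj_coords n"
    by (auto simp: proj_rel_def)
  show "refl_on (proj_coords n) (proj_rel n)"
    by (auto simp: refl_on_def proj_rel_def intro!: exI[of _ 1])
  show "sym (proj_rel n)"
  proof (rule symI)
    fix u v assume "(u, v) \<in> proj_rel n"
    then obtain s where "u \<in> proj_coords n" "v \<in> proj_coords n" "s \<noteq> 0" "v = (\<lambda>i. s * u i)"
      by (auto simp: proj_rel_def)
    then show "(v, u) \<in> proj_rel n"
      unfolding proj_rel_def by (auto intro!: exI[of _ "inverse s"])
  qed
  show "trans (proj_rel n)"
  proof (rule transI)
    fix u v x assume "(u, v) \<in> proj_rel n" "(v, x) \<in> proj_rel n"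
    then obtain s t where "u \<in> proj_coords n" "x \<in> proj_coords n" "s \<noteq> 0" "t \<noteq> 0"
      "v = (\<lambda>i. s * u i)" "x = (\<lambda>i. t * v i)"
      by (auto simp: proj_rel_def)
    then show "(u, x) \<in> proj_rel n"
      unfolding proj_rel_def by (auto intro!: exI[of _ "t * s"])
  qed
qed

theorem phi_eq:
  assumes F: "is_forest F" and w: "is_weight F w"
    and v: "v \<in> (\<Pi>\<^sub>E \<alpha>\<in>{1..num_trees F}. proj_coords 1)"
  shows "phi F w (\<lambda>\<alpha>\<in>{1..num_trees F}. proj_point 1 (v \<alpha>)) =
    proj_point (ambient_dim F) (phi_coords F w v)"
proof -
  let ?J = "{1..num_trees F}" and ?m = "ambient_dim F"
  let ?V = "\<Pi>\<^sub>E \<alpha>\<in>?J. (\<lambda>\<alpha>\<in>?J. proj_point 1 (v \<alpha>)) \<alpha>"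
  have same: "proj_point ?m (phi_coords F w v') = proj_point ?m (phi_coords F w v)"
    if v': "v' \<in> ?V" for v'
  proof -
    have "(v \<alpha>, v' \<alpha>) \<in> proj_rel 1" if "\<alpha> \<in> ?J" for \<alpha>
      using PiE_mem[OF v' that] that by (simp add: proj_point_def)
    then have "\<forall>\<alpha>\<in>?J. \<exists>s. s \<noteq> 0 \<and> v' \<alpha> = (\<lambda>i. s * v \<alpha> i)"
      and v'1: "\<And>\<alpha>. \<alpha> \<in> ?J \<Longrightarrow> v' \<alpha> \<in> proj_coords 1"
      by (auto simp: proj_rel_def)
    then obtain s where s: "\<And>\<alpha>. \<alpha> \<in> ?J \<Longrightarrow> s \<alpha> \<noteq> 0 \<and> v' \<alpha> = (\<lambda>i. s \<alpha> * v \<alpha> i)"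
      by metis
    have "phi_coords F w v \<in> proj_coords ?m" "phi_coords F w v' \<in> proj_coords ?m"
      using v v'1 by (auto intro!: phi_coords_in[OF F w])
    moreover have "(\<Prod>\<alpha>\<in>?J. s \<alpha> ^ max_degree F w \<alpha>) \<noteq> 0"
      using s by simp
    moreover have "phi_coords F w v' =
        (\<lambda>\<kappa>. (\<Prod>\<alpha>\<in>?J. s \<alpha> ^ max_degree F w \<alpha>) * phi_coords F w v \<kappa>)"
      by (rule phi_coords_scale[OF F w]) (use s in auto)
    ultimately have "(phi_coords F w v, phi_coords F w v') \<in> proj_rel ?m"
      unfolding proj_rel_def by blast
    then show ?thesis
      unfolding proj_point_def using equiv_class_eq[OF equiv_proj_rel] by metis
  qed
  have "v \<in> ?V"
  proof (rule PiE_I)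
    fix \<alpha> assume \<alpha>: "\<alpha> \<in> ?J"
    then have "v \<alpha> \<in> proj_coords 1" using v by auto
    then show "v \<alpha> \<in> (\<lambda>\<alpha>\<in>?J. proj_point 1 (v \<alpha>)) \<alpha>"
      using \<alpha> equiv_class_self[OF equiv_proj_rel] by (simp add: proj_point_def)
  qed (use v in \<open>auto simp: PiE_def extensional_def\<close>)
  then show ?thesis
    unfolding phi_def using same by blast
qed

theorem phi_in_proj_space:
  assumes F: "is_forest F" and w: "is_weight F w" and p: "p \<in> P1_power (num_trees F)"
  shows "phi F w p \<in> proj_space (ambient_dim F)"
proof -
  let ?J = "{1..num_trees F}"
  have "\<forall>\<alpha>\<in>?J. \<exists>u. u \<in> proj_coords 1 \<and> p \<alpha> = proj_point 1 u"
    using p by (force simp: P1_power_def proj_space_def proj_point_def elim!: quotientE dest: PiE_mem)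
  then obtain u where u: "\<And>\<alpha>. \<alpha> \<in> ?J \<Longrightarrow> u \<alpha> \<in> proj_coords 1 \<and> p \<alpha> = proj_point 1 (u \<alpha>)"
    by metis
  let ?v = "restrict u ?J"
  have v: "?v \<in> (\<Pi>\<^sub>E \<alpha>\<in>?J. proj_coords 1)" using u by auto
  have "p = (\<lambda>\<alpha>\<in>?J. proj_point 1 (?v \<alpha>))"
    using p u by (auto simp: P1_power_def fun_eq_iff PiE_def extensional_def)
  then have "phi F w p = proj_point (ambient_dim F) (phi_coords F w ?v)"
    using phi_eq[OF F w v] by simp
  moreover have "phi_coords F w ?v \<in> proj_coords (ambient_dim F)"
    using u by (auto intro!: phi_coords_in[OF F w])
  ultimately show ?thesis
    by (simp add: proj_space_def proj_point_def quotientI)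
qed

text \<open>On the affine part, \<open>\<phi>\<close> is given by the values of the \<open>\<lambda>\<^sub>\<kappa>\<close>, that is, by the
  coefficients of the polynomial obtained from \<open>frakP\<close> by substituting numbers for the \<open>c\<^sub>\<alpha>\<close>.\<close>

lemma phi_coords_affine:
  assumes "\<kappa> \<le> ambient_dim F" "\<And>\<alpha>. \<alpha> \<in> {1..num_trees F} \<Longrightarrow> v \<alpha> 0 = c \<alpha> \<and> v \<alpha> 1 = 1"
  shows "phi_coords F w v \<kappa> = (\<Sum>\<mu>\<in>Poly_Mapping.keys (coeff (frakP F w) \<kappa>).
    Poly_Mapping.lookup (coeff (frakP F w) \<kappa>) \<mu> * (\<Prod>\<alpha>\<in>{1..num_trees F}. c \<alpha> ^ mdeg \<mu> \<alpha>))"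
  using assms by (simp add: phi_coords_def hom_value_def)

end

theory Submission
  imports Defs
begin

text \<open>Up to homogenization, the coordinates of \<open>\<phi>\<close> are the coefficients of a product of factors
  \<open>c'\<^sub>\<alpha>\<^sup>e Y\<^sup>n + a c\<^sub>\<alpha>\<^sup>e\<close>, one for each node which is not a ramification node, where \<open>a\<close> is, up to
  sign, the weight of a node \<open>x\<close> of depth \<open>k\<close> and \<open>e = 2\<^bsup>d - k\<^esup>\<close>. Shifting the weight by
  \<open>h\<^sub>\<alpha> \<in> \<int>/2\<^sup>d\<close> multiplies \<open>a\<close> by \<open>\<zeta>\<^sub>\<alpha>\<^sup>e\<close> with \<open>\<zeta>\<^sub>\<alpha> = exp (2\<pi>\<i> h\<^sub>\<alpha> / 2\<^sup>d)\<close>, which has the same effect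
  as replacing \<open>c\<^sub>\<alpha>\<close> by \<open>\<zeta>\<^sub>\<alpha> c\<^sub>\<alpha>\<close>. An automorphism of the forest permutes the factors and the indices
  \<open>\<alpha>\<close>. Hence both actions are induced by bijections of \<open>(\<bbbP>\<^sup>1)\<^sup>j\<close>.\<close>

section \<open>Depth and induction along the edges of a forest\<close>

lemma node_depth_eqI:
  assumes T: "is_tree T" and n: "(root_node T, y) \<in> edge_set T ^^ n"
  shows "node_depth T y = n"
proof -
  \<comment> \<open>A node with a parent is not the root and has only that parent, so two root paths
    to it can be shortened by the same last edge. Hence every root path to a node has the same
    length, and the \<open>LEAST\<close> in \<open>node_depth\<close> is attained by any of
    them.\<close>
  have "m = n" if "(root_node T, y) \<in> edge_set T ^^ n" "(root_node T, y) \<in> edge_set T ^^ m" for n m y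
    using that
  proof (induction n arbitrary: m y)
    case 0
    then show ?case using T by (cases m) (auto simp: is_tree_def)
  next
    case (Suc n)
    then obtain z where z: "(root_node T, z) \<in> edge_set T ^^ n" "(z, y) \<in> edge_set T"
      by auto
    have "y \<noteq> root_node T" "y \<in> node_set T"
      using T z(2) by (auto simp: is_tree_def)
    then have "m \<noteq> 0" using Suc.prems(2) by (cases m) auto
    then obtain l x where l: "m = Suc l" "(root_node T, x) \<in> edge_set T ^^ l" "(x, y) \<in> edge_set T"
      using Suc.prems(2) by (cases m) auto
    have "x = z"
      using T z(2) l(3) \<open>y \<noteq> root_node T\<close> \<open>y \<in> node_set T\<close> unfolding is_tree_def by blast
    then show ?case using Suc.IH[OF z(1)] l by simp
  qed
  then show ?thesis
    unfolding node_depth_def using n by (intro Least_equality) auto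
qed

lemma root_path:
  assumes "is_tree T" "y \<in> node_set T"
  shows "(root_node T, y) \<in> edge_set T ^^ node_depth T y"
proof -
  obtain n where "(root_node T, y) \<in> edge_set T ^^ n"
    using assms unfolding is_tree_def by (metis rtrancl_imp_relpow)
  then show ?thesis using node_depth_eqI[OF assms(1)] by blast
qed

lemma depth_child:
  assumes F: "is_forest F" and x: "x \<in> forest_nodes F" and y: "y \<in> children F x"
  shows "tree_index F y = tree_index F x" "depth F y = Suc (depth F x)"
proof -
  let ?T = "tree F (tree_index F x)"
  note i = tree_index_in[OF F x]
  have T: "is_tree ?T" using F i(1) by (auto simp: is_forest_def)
  have e: "(x, y) \<in> edge_set ?T"
    using children_tree[OF F i] y by auto
  then have "y \<in> node_set ?T" using T by (auto simp: is_tree_def)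
  then show idx: "tree_index F y = tree_index F x"
    by (rule tree_index_eq[OF F i(1)])
  have "(root_node ?T, y) \<in> edge_set ?T ^^ Suc (depth F x)"
    using root_path[OF T i(2)] e by (auto simp: depth_def)
  then show "depth F y = Suc (depth F x)"
    using node_depth_eqI[OF T] by (simp add: depth_def idx)
qed

lemma depth_le_tree_depth:
  assumes F: "is_forest F" and x: "x \<in> forest_nodes F"
  shows "depth F x \<le> tree_depth (tree F (tree_index F x))"
  using tree_index_in[OF F x] F
  by (auto simp: tree_depth_def depth_def is_forest_def is_tree_def intro!: Max_ge)

lemma depth_root:
  assumes F: "is_forest F" and \<alpha>: "\<alpha> \<in> {1..num_trees F}"
  shows "tree_index F (root_node (tree F \<alpha>)) = \<alpha>" "depth F (root_node (tree F \<alpha>)) = 0"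
    "root_node (tree F \<alpha>) \<in> forest_nodes F"
proof -
  have T: "is_tree (tree F \<alpha>)" using F \<alpha> by (auto simp: is_forest_def)
  then have r: "root_node (tree F \<alpha>) \<in> node_set (tree F \<alpha>)" by (auto simp: is_tree_def)
  show i: "tree_index F (root_node (tree F \<alpha>)) = \<alpha>" by (rule tree_index_eq[OF F \<alpha> r])
  show "depth F (root_node (tree F \<alpha>)) = 0"
    unfolding depth_def i by (rule node_depth_eqI[OF T]) simp
  show "root_node (tree F \<alpha>) \<in> forest_nodes F" using r \<alpha> by (auto simp: forest_nodes_def)
qed

text \<open>Every node is reached from the root of its tree by edges, so whatever holds at roots and
  passes from parent to child holds everywhere.\<close>

lemma forest_induct [consumes 2, case_names root child]:
  assumes F: "is_forest F" and y: "y \<in> forest_nodes F"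
    and root: "\<And>\<alpha>. \<alpha> \<in> {1..num_trees F} \<Longrightarrow> P (root_node (tree F \<alpha>))"
    and child: "\<And>x y. x \<in> forest_nodes F \<Longrightarrow> y \<in> children F x \<Longrightarrow> P x \<Longrightarrow> P y"
  shows "P y"
proof -
  let ?T = "tree F (tree_index F y)"
  note i = tree_index_in[OF F y]
  have T: "is_tree ?T" using F i(1) by (auto simp: is_forest_def)
  then have "(root_node ?T, y) \<in> (edge_set ?T)\<^sup>*" using i(2) by (auto simp: is_tree_def)
  then show "P y"
  proof (induction rule: rtrancl_induct)
    case base
    show ?case using root i(1) by blast
  next
    case (step x z)
    have "x \<in> node_set ?T" using step T by (auto simp: is_tree_def)
    then show ?case
      using step i(1) by (intro child[of x z]) (auto simp: forest_nodes_def children_def forest_edges_def)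
  qed
qed

section \<open>Automorphisms: induced permutation of the trees, preserved depths\<close>

definition aut_index :: "'a forest \<Rightarrow> ('a \<Rightarrow> 'a) \<Rightarrow> nat \<Rightarrow> nat" where
  "aut_index F g \<alpha> = tree_index F (g (root_node (tree F \<alpha>)))"

context
  fixes F :: "'a forest" and g :: "'a \<Rightarrow> 'a"
  assumes F: "is_forest F" and g: "g \<in> Aut F"
begin

lemma aut_permutes: "g permutes forest_nodes F"
  using g by (simp add: Aut_def)

lemma aut_in: "g x \<in> forest_nodes F \<longleftrightarrow> x \<in> forest_nodes F"
  by (rule permutes_in_image[OF aut_permutes])

lemma aut_inj: "inj g"
  by (rule permutes_inj[OF aut_permutes])

text \<open>\<open>Aut\<close> compares edges only between nodes of the form \<open>g x\<close> and
  \<open>g y\<close>. That every child of \<open>g x\<close> has this form uses that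
  \<open>g\<close> is onto the nodes.\<close>

lemma aut_children:
  assumes x: "x \<in> forest_nodes F"
  shows "children F (g x) = g ` children F x"
proof (intro equalityI subsetI)
  fix y assume y: "y \<in> children F (g x)"
  then have "y \<in> forest_nodes F"
    using children_props(1)[OF F] x aut_in by blast
  then obtain z where z: "z \<in> forest_nodes F" "y = g z"
    using permutes_image[OF aut_permutes] by blast
  then show "y \<in> g ` children F x"
    using y g x by (auto simp: Aut_def children_def)
next
  fix y assume "y \<in> g ` children F x"
  then obtain z where z: "z \<in> children F x" "y = g z" by blast
  then have "z \<in> forest_nodes F" using children_props(1)[OF F x] by blast
  then show "y \<in> children F (g x)"
    using z g x by (auto simp: Aut_def children_def)
qed

lemma aut_final: "g x \<in> final_nodes F \<longleftrightarrow> x \<in> final_nodes F"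
  using aut_children[of x] aut_in[of x] by (auto simp: final_nodes_def)

lemma aut_ramification: "g x \<in> ramification_nodes F \<longleftrightarrow> x \<in> ramification_nodes F"
  using aut_children[of x] aut_in[of x] card_image[OF inj_on_subset[OF aut_inj subset_UNIV]]
  by (auto simp: ramification_nodes_def)

lemma aut_only_child:
  assumes x: "x \<in> unary_nodes F"
  shows "only_child F (g x) = g (only_child F x)"
proof -
  obtain y where y: "children F x = {y}"
    using card_children_unary[OF F x] by (meson card_1_singletonE)
  then have "children F (g x) = {g y}" using aut_children[of x] x by auto
  then show ?thesis using y by (simp add: only_child_def)
qed

lemma aut_root:
  assumes \<alpha>: "\<alpha> \<in> {1..num_trees F}"
  shows "aut_index F g \<alpha> \<in> {1..num_trees F}"
    "g (root_node (tree F \<alpha>)) = root_node (tree F (aut_index F g \<alpha>))"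
proof -
  have "g (root_node (tree F \<alpha>)) \<in> forest_roots F"
    using g \<alpha> unfolding Aut_def forest_roots_def by blast
  then obtain \<beta> where \<beta>: "\<beta> \<in> {1..num_trees F}" "g (root_node (tree F \<alpha>)) = root_node (tree F \<beta>)"
    by (auto simp: forest_roots_def)
  then have "aut_index F g \<alpha> = \<beta>" by (simp add: aut_index_def depth_root(1)[OF F])
  then show "aut_index F g \<alpha> \<in> {1..num_trees F}"
    "g (root_node (tree F \<alpha>)) = root_node (tree F (aut_index F g \<alpha>))"
    using \<beta> by auto
qed

text \<open>Roots go to roots and children to children. A child inherits the tree index of its
  parent and has depth one more, so both claims propagate down from the roots.\<close>

lemma aut_index_depth:
  assumes "x \<in> forest_nodes F"
  shows "tree_index F (g x) = aut_index F g (tree_index F x) \<and> depth F (g x) = depth F x"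
  using F assms
proof (induction rule: forest_induct)
  case (root \<alpha>)
  then show ?case
    using aut_root[OF root] by (simp add: depth_root[OF F])
next
  case (child x y)
  have "g y \<in> children F (g x)" using aut_children child by blast
  then show ?case
    using child aut_in by (simp add: depth_child[OF F, of "g x" "g y"] depth_child[OF F, of x y])
qed

text \<open>Distinct trees have distinct roots and \<open>g\<close> is injective on them; an
  injective self-map of a finite set is onto.\<close>

lemma bij_aut_index: "bij_betw (aut_index F g) {1..num_trees F} {1..num_trees F}"
proof -
  have "inj_on (aut_index F g) {1..num_trees F}"
  proof (rule inj_onI)
    fix \<alpha> \<beta> assume *: "\<alpha> \<in> {1..num_trees F}" "\<beta> \<in> {1..num_trees F}" "aut_index F g \<alpha> = aut_index F g \<beta>"
    then have "g (root_node (tree F \<alpha>)) = g (root_node (tree F \<beta>))"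
      by (simp only: aut_root)
    then have "root_node (tree F \<alpha>) = root_node (tree F \<beta>)"
      using aut_inj by (simp add: inj_eq)
    then show "\<alpha> = \<beta>" using * depth_root(1)[OF F] by metis
  qed
  moreover have "aut_index F g ` {1..num_trees F} \<subseteq> {1..num_trees F}"
    using aut_root(1) by blast
  ultimately show ?thesis
    by (simp add: bij_betw_def endo_inj_surj)
qed

lemma aut_node_set:
  assumes \<alpha>: "\<alpha> \<in> {1..num_trees F}"
  shows "node_set (tree F (aut_index F g \<alpha>)) = g ` node_set (tree F \<alpha>)"
proof (intro equalityI subsetI)
  fix y assume y: "y \<in> node_set (tree F (aut_index F g \<alpha>))"
  then have "y \<in> forest_nodes F" using aut_root(1)[OF \<alpha>] by (auto simp: forest_nodes_def)
  then obtain x where x: "x \<in> forest_nodes F" "y = g x"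
    using permutes_image[OF aut_permutes] by blast
  \<comment> \<open>Injectivity of the index map will force the preimage \<open>x\<close> into tree
    \<alpha>.\<close>
  have "aut_index F g (tree_index F x) = aut_index F g \<alpha>"
    using aut_index_depth[OF x(1)] tree_index_eq[OF F aut_root(1)[OF \<alpha>] y] x(2) by simp
  then have "tree_index F x = \<alpha>"
    using bij_aut_index tree_index_in(1)[OF F x(1)] \<alpha> by (auto simp: bij_betw_def dest: inj_onD)
  then show "y \<in> g ` node_set (tree F \<alpha>)"
    using x tree_index_in(2)[OF F x(1)] by auto
next
  fix y assume "y \<in> g ` node_set (tree F \<alpha>)"
  then obtain x where x: "x \<in> node_set (tree F \<alpha>)" "y = g x" by blast
  then have xF: "x \<in> forest_nodes F" using \<alpha> by (auto simp: forest_nodes_def)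
  then show "y \<in> node_set (tree F (aut_index F g \<alpha>))"
    using tree_index_in(2)[OF F, of "g x"] aut_index_depth[OF xF] tree_index_eq[OF F \<alpha> x(1)]
      aut_in x(2) by simp
qed

lemma aut_tree_depth:
  assumes \<alpha>: "\<alpha> \<in> {1..num_trees F}"
  shows "tree_depth (tree F (aut_index F g \<alpha>)) = tree_depth (tree F \<alpha>)"
proof -
  have "node_depth (tree F (aut_index F g \<alpha>)) (g x) = node_depth (tree F \<alpha>) x"
    if x: "x \<in> node_set (tree F \<alpha>)" for x
  proof -
    have "x \<in> forest_nodes F" using x \<alpha> by (auto simp: forest_nodes_def)
    from aut_index_depth[OF this]
    have "tree_index F (g x) = aut_index F g \<alpha>" "depth F (g x) = depth F x"
      by (simp_all add: tree_index_eq[OF F \<alpha> x])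
    then show ?thesis by (simp add: depth_def tree_index_eq[OF F \<alpha> x])
  qed
  then show ?thesis
    unfolding tree_depth_def aut_node_set[OF \<alpha>] image_image by (metis (no_types, lifting) image_cong)
qed

lemma aut_factor_exp:
  assumes "x \<in> forest_nodes F"
  shows "factor_exp F (g x) = factor_exp F x"
  using aut_index_depth[OF assms] aut_tree_depth[OF tree_index_in(1)[OF F assms]]
  by (simp add: factor_exp_def aut_final)

end

section \<open>The map as a product of homogenized factors, and its image\<close>

definition hom_factor :: "'a forest \<Rightarrow> ('a \<Rightarrow> complex) \<Rightarrow> (nat \<Rightarrow> nat \<Rightarrow> complex) \<Rightarrow> 'a \<Rightarrow> complex poly" where
  "hom_factor F w v u =
     (if u \<in> final_nodes F
      then monom (v (tree_index F u) 1 ^ factor_exp F u) 2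
        + [:- w u * v (tree_index F u) 0 ^ factor_exp F u:]
      else monom (v (tree_index F u) 1 ^ factor_exp F u) 1
        + [:w (only_child F u) * v (tree_index F u) 0 ^ factor_exp F u:])"

text \<open>Homogenization is multiplicative when the degree bounds add up, and the maximal degree
  in each variable is exactly the sum of the degrees of the factors. So each factor may be
  homogenized on its own.\<close>

lemma phi_coords_prod:
  assumes F: "is_forest F" and w: "is_weight F w" and \<kappa>: "\<kappa> \<le> ambient_dim F"
  shows "phi_coords F w v \<kappa> = coeff (\<Prod>u\<in>final_nodes F \<union> unary_nodes F. hom_factor F w v u) \<kappa>"
proof -
  let ?A = "final_nodes F \<union> unary_nodes F" and ?J = "{1..num_trees F}"
  let ?D = "\<lambda>u \<alpha>. if \<alpha> = tree_index F u then factor_exp F u else 0"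
  let ?c = "\<lambda>\<alpha>. v \<alpha> 0" and ?c' = "\<lambda>\<alpha>. v \<alpha> 1"
  have fin: "finite ?A"
    using finite_forest_nodes[OF F] by (auto simp: final_nodes_def)
  have b: "poly_bounded ?J (?D u) (factor_poly F w u)" for u
    by (simp add: factor_poly_def poly_bounded_factor)
  have tot: "total_exp F = (\<lambda>\<alpha>. \<Sum>u\<in>?A. ?D u \<alpha>)"
    by (rule ext) (simp add: total_exp_def)
  have "hom_poly ?J (?D u) ?c ?c' (factor_poly F w u) = hom_factor F w v u" if "u \<in> ?A" for u
  proof -
    have "tree_index F u \<in> ?J"
      using that tree_index_in(1)[OF F] by (auto simp: final_nodes_def)
    then show ?thesis
      by (simp only: factor_poly_def hom_factor_def hom_poly_factor finite_atLeastAtMost split: if_split) simp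
  qed
  then have "hom_poly ?J (total_exp F) ?c ?c' (frakP F w) = (\<Prod>u\<in>?A. hom_factor F w v u)"
    unfolding tot frakP_factors[OF F]
    using hom_poly_prod[where D = ?D and P = "factor_poly F w", OF fin b] by simp
  then have "coeff (\<Prod>u\<in>?A. hom_factor F w v u) \<kappa> = hom_value ?J (total_exp F) ?c ?c' (coeff (frakP F w) \<kappa>)"
    by (metis coeff_hom_poly)
  then show ?thesis
    using \<kappa> hom_value_cong[of ?J "max_degree F w" "total_exp F"] max_degree_eq[OF F w]
    by (simp add: phi_coords_def)
qed

text \<open>By \<open>phi_eq\<close> any homogeneous coordinates compute \<open>phi\<close>, so
  images can be compared on coordinate vectors instead of classes.\<close>

lemma phi_image:
  assumes F: "is_forest F" and w: "is_weight F w"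
  shows "phi F w ` P1_power (num_trees F) =
    (\<lambda>v. proj_point (ambient_dim F) (phi_coords F w v)) ` (\<Pi>\<^sub>E \<alpha>\<in>{1..num_trees F}. proj_coords 1)"
proof (intro equalityI subsetI)
  let ?J = "{1..num_trees F}"
  fix q assume "q \<in> phi F w ` P1_power (num_trees F)"
  then obtain p where p: "p \<in> P1_power (num_trees F)" "q = phi F w p" by blast
  have "\<forall>\<alpha>\<in>?J. \<exists>u. u \<in> proj_coords 1 \<and> p \<alpha> = proj_point 1 u"
    using p by (force simp: P1_power_def proj_space_def proj_point_def elim!: quotientE dest: PiE_mem)
  then obtain u where u: "\<And>\<alpha>. \<alpha> \<in> ?J \<Longrightarrow> u \<alpha> \<in> proj_coords 1 \<and> p \<alpha> = proj_point 1 (u \<alpha>)"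
    by metis
  let ?v = "restrict u ?J"
  have v: "?v \<in> (\<Pi>\<^sub>E \<alpha>\<in>?J. proj_coords 1)" using u by auto
  have "p = (\<lambda>\<alpha>\<in>?J. proj_point 1 (?v \<alpha>))"
    using p u by (auto simp: P1_power_def fun_eq_iff PiE_def extensional_def)
  then have "q = proj_point (ambient_dim F) (phi_coords F w ?v)"
    using phi_eq[OF F w v] p(2) by simp
  then show "q \<in> (\<lambda>v. proj_point (ambient_dim F) (phi_coords F w v)) ` (\<Pi>\<^sub>E \<alpha>\<in>?J. proj_coords 1)"
    using v by blast
next
  let ?J = "{1..num_trees F}"
  fix q assume "q \<in> (\<lambda>v. proj_point (ambient_dim F) (phi_coords F w v)) ` (\<Pi>\<^sub>E \<alpha>\<in>?J. proj_coords 1)"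
  then obtain v where v: "v \<in> (\<Pi>\<^sub>E \<alpha>\<in>?J. proj_coords 1)"
    "q = proj_point (ambient_dim F) (phi_coords F w v)" by blast
  have "(\<lambda>\<alpha>\<in>?J. proj_point 1 (v \<alpha>)) \<in> P1_power (num_trees F)"
    using v(1) by (auto simp: P1_power_def proj_space_def proj_point_def intro!: quotientI)
  then show "q \<in> phi F w ` P1_power (num_trees F)"
    using phi_eq[OF F w v(1)] v(2) by (metis imageI)
qed

section \<open>Invariance of the image under twisted automorphisms\<close>

lemma phi_coords_aut:
  assumes F: "is_forest F" and g: "g \<in> Aut F" and w: "is_weight F w" and w': "is_weight F w'"
    and \<zeta>: "\<And>x. x \<in> forest_nodes F \<Longrightarrow> w' (g x) =
      \<zeta> (tree_index F x) ^ (2 ^ (tree_depth (tree F (tree_index F x)) - depth F x)) * w x"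
    and v: "\<And>\<alpha>. \<alpha> \<in> {1..num_trees F} \<Longrightarrow>
      v \<alpha> 0 = \<zeta> \<alpha> * v' (aut_index F g \<alpha>) 0 \<and> v \<alpha> 1 = v' (aut_index F g \<alpha>) 1"
  shows "phi_coords F w v = phi_coords F w' v'"
proof
  fix \<kappa>
  let ?A = "final_nodes F \<union> unary_nodes F"
  \<comment> \<open>The number of children decides whether a node contributes a factor, and
    \<open>g\<close> preserves it.\<close>
  have bij: "bij_betw g ?A ?A"
  proof (rule bij_betw_imageI)
    show "inj_on g ?A" using aut_inj[OF F g] by (rule inj_on_subset) simp
    show "g ` ?A = ?A"
    proof (intro equalityI subsetI)
      fix y assume y: "y \<in> ?A"
      then have "y \<in> forest_nodes F" by (auto simp: final_nodes_def)
      then obtain x where "y = g x"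
        using permutes_image[OF aut_permutes[OF F g]] by blast
      then show "y \<in> g ` ?A"
        using y by (auto simp: aut_in[OF F g] aut_final[OF F g] aut_ramification[OF F g])
    qed (auto simp: aut_in[OF F g] aut_final[OF F g] aut_ramification[OF F g])
  qed
  \<comment> \<open>The powers of \<zeta> in the twisted weight are absorbed by the first coordinate
    of \<open>v\<close>, so the factors agree exactly, with no scalar left over.\<close>
  have "hom_factor F w' v' (g x) = hom_factor F w v x" if x: "x \<in> ?A" for x
  proof -
    have xF: "x \<in> forest_nodes F" using x by (auto simp: final_nodes_def)
    let ?\<alpha> = "tree_index F x"
    have i: "tree_index F (g x) = aut_index F g ?\<alpha>" "factor_exp F (g x) = factor_exp F x"
      using aut_index_depth[OF F g xF] aut_factor_exp[OF F g xF] by auto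
    note v\<alpha> = v[OF tree_index_in(1)[OF F xF]]
    show ?thesis
    proof (cases "x \<in> final_nodes F")
      case True
      then have "w' (g x) = \<zeta> ?\<alpha> ^ factor_exp F x * w x"
        using \<zeta>[OF xF] by (simp add: factor_exp_def Let_def)
      then show ?thesis
        using True v\<alpha> by (simp add: hom_factor_def aut_final[OF F g] i power_mult_distrib)
    next
      case False
      then have xu: "x \<in> unary_nodes F" using x by simp
      let ?y = "only_child F x"
      have y: "?y \<in> children F x" by (rule only_child_in[OF F xu])
      then have yF: "?y \<in> forest_nodes F" using children_props(1)[OF F xF] by blast
      \<comment> \<open>The child lies one level deeper, so its twist exponent is
        \<open>2 ^ (d - k - 1)\<close> for \<open>x\<close> of depth \<open>k\<close> in a tree of
        depth \<open>d\<close>: the exponent of the linear factor at \<open>x\<close>.\<close>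
      have "w' (g ?y) = \<zeta> ?\<alpha> ^ factor_exp F x * w ?y"
        using \<zeta>[OF yF] False by (simp add: depth_child[OF F xF y] factor_exp_def Let_def)
      then show ?thesis
        using False v\<alpha>
        by (simp add: hom_factor_def aut_final[OF F g] i power_mult_distrib aut_only_child[OF F g xu])
    qed
  qed
  then have "(\<Prod>u\<in>?A. hom_factor F w v u) = (\<Prod>u\<in>?A. hom_factor F w' v' u)"
    by (subst prod.reindex_bij_betw[OF bij, symmetric]) simp
  then show "phi_coords F w v \<kappa> = phi_coords F w' v' \<kappa>"
    by (cases "\<kappa> \<le> ambient_dim F")
       (simp_all add: phi_coords_prod[OF F w] phi_coords_prod[OF F w'], simp add: phi_coords_def)
qed

text \<open>The relation between \<open>v\<close> and \<open>v'\<close> in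
  \<open>phi_coords_aut\<close> can be solved for either one, because \<zeta> does not vanish and
  the index map is bijective. This gives both inclusions.\<close>

lemma phi_image_aut:
  assumes F: "is_forest F" and g: "g \<in> Aut F" and w: "is_weight F w" and w': "is_weight F w'"
    and nz: "\<And>\<alpha>. \<alpha> \<in> {1..num_trees F} \<Longrightarrow> \<zeta> \<alpha> \<noteq> 0"
    and \<zeta>: "\<And>x. x \<in> forest_nodes F \<Longrightarrow> w' (g x) =
      \<zeta> (tree_index F x) ^ (2 ^ (tree_depth (tree F (tree_index F x)) - depth F x)) * w x"
  shows "phi F w ` P1_power (num_trees F) = phi F w' ` P1_power (num_trees F)"
proof -
  let ?J = "{1..num_trees F}"
  let ?V = "\<Pi>\<^sub>E \<alpha>\<in>?J. proj_coords 1" and ?\<sigma> = "aut_index F g"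
  note bij = bij_aut_index[OF F g]
  have scale: "(\<lambda>i. if i = 0 then s * u 0 else u i) \<in> proj_coords 1" if "u \<in> proj_coords 1" "s \<noteq> 0"
    for s u
  proof -
    have "u \<in> proj_coords 1 \<longleftrightarrow> (\<forall>i>1. u i = 0) \<and> (u 0 \<noteq> 0 \<or> u 1 \<noteq> 0)" for u
      by (auto simp: proj_coords_def le_Suc_eq)
    then show ?thesis using that by simp
  qed
  have 1: "\<exists>v\<in>?V. phi_coords F w v = phi_coords F w' v'" if v': "v' \<in> ?V" for v'
  proof -
    \<comment> \<open>This is the relation read as a definition of \<open>v\<close>. Entries beyond
      1 are copied too, so they stay zero as \<open>proj_coords\<close> demands.\<close>
    let ?v = "\<lambda>\<alpha>\<in>?J. \<lambda>i. if i = 0 then \<zeta> \<alpha> * v' (?\<sigma> \<alpha>) 0 else v' (?\<sigma> \<alpha>) i"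
    have "?v \<in> ?V"
    proof (rule restrict_PiE_iff[THEN iffD2], rule ballI)
      fix \<alpha> assume \<alpha>: "\<alpha> \<in> ?J"
      have "v' (?\<sigma> \<alpha>) \<in> proj_coords 1"
        using v' bij_betwE[OF bij] \<alpha> by blast
      then show "(\<lambda>i. if i = 0 then \<zeta> \<alpha> * v' (?\<sigma> \<alpha>) 0 else v' (?\<sigma> \<alpha>) i) \<in> proj_coords 1"
        by (rule scale) (rule nz[OF \<alpha>])
    qed
    moreover have "phi_coords F w ?v = phi_coords F w' v'"
      by (rule phi_coords_aut[OF F g w w' \<zeta>]) auto
    ultimately show ?thesis by blast
  qed
  have 2: "\<exists>v'\<in>?V. phi_coords F w v = phi_coords F w' v'" if v: "v \<in> ?V" for v
  proof -
    let ?\<tau> = "inv_into ?J ?\<sigma>"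
    \<comment> \<open>The inverse substitution: go back to the tree sent to \<beta> and divide out
      its \<zeta>.\<close>
    let ?v' = "\<lambda>\<beta>\<in>?J. \<lambda>i. if i = 0 then inverse (\<zeta> (?\<tau> \<beta>)) * v (?\<tau> \<beta>) 0 else v (?\<tau> \<beta>) i"
    have "?v' \<in> ?V"
    proof (rule restrict_PiE_iff[THEN iffD2], rule ballI)
      fix \<beta> assume "\<beta> \<in> ?J"
      then have \<tau>: "?\<tau> \<beta> \<in> ?J" using bij_betwE[OF bij_betw_inv_into[OF bij]] by blast
      then have "v (?\<tau> \<beta>) \<in> proj_coords 1" using v by blast
      then show "(\<lambda>i. if i = 0 then inverse (\<zeta> (?\<tau> \<beta>)) * v (?\<tau> \<beta>) 0 else v (?\<tau> \<beta>) i) \<in> proj_coords 1"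
        by (rule scale) (use nz[OF \<tau>] in simp)
    qed
    moreover have "phi_coords F w v = phi_coords F w' ?v'"
    proof (rule phi_coords_aut[OF F g w w' \<zeta>])
      fix \<alpha> assume \<alpha>: "\<alpha> \<in> ?J"
      then have "?\<sigma> \<alpha> \<in> ?J" "?\<tau> (?\<sigma> \<alpha>) = \<alpha>"
        using bij by (auto simp: bij_betw_inv_into_left dest: bij_betwE)
      then show "v \<alpha> 0 = \<zeta> \<alpha> * ?v' (?\<sigma> \<alpha>) 0 \<and> v \<alpha> 1 = ?v' (?\<sigma> \<alpha>) 1"
        using nz[OF \<alpha>] by simp
    qed auto
    ultimately show ?thesis by blast
  qed
  show ?thesis
    unfolding phi_image[OF F w] phi_image[OF F w']
  proof (intro equalityI image_subsetI)
    fix v assume "v \<in> ?V"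
    then obtain v' where "v' \<in> ?V" "phi_coords F w v = phi_coords F w' v'" using 2 by blast
    then show "proj_point (ambient_dim F) (phi_coords F w v) \<in>
        (\<lambda>v. proj_point (ambient_dim F) (phi_coords F w' v)) ` ?V"
      by (intro image_eqI[of _ _ v']) simp_all
  next
    fix v' assume "v' \<in> ?V"
    then obtain v where "v \<in> ?V" "phi_coords F w v = phi_coords F w' v'" using 1 by blast
    then show "proj_point (ambient_dim F) (phi_coords F w' v') \<in>
        (\<lambda>v. proj_point (ambient_dim F) (phi_coords F w v)) ` ?V"
      by (intro image_eqI[of _ _ v]) simp_all
  qed
qed

section \<open>The shift group as multiplication by roots of unity\<close>

lemma exp_mod_root:
  assumes "n > 0"
  shows "exp (2 * pi * \<i> * of_int (a mod int n) / of_nat n) = exp (2 * pi * \<i> * of_int a / of_nat n)"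
proof -
  have "(of_int a :: complex) = of_int (a mod int n) + of_int (a div int n) * of_nat n"
    by (metis mod_div_mult_eq of_int_add of_int_mult of_int_of_nat_eq)
  then have "2 * pi * \<i> * of_int a / of_nat n =
      2 * pi * \<i> * of_int (a mod int n) / of_nat n + of_int (2 * (a div int n)) * pi * \<i>"
    using assms by (simp add: field_simps)
  then show ?thesis by (metis exp_eq)
qed

text \<open>The exponential ignores reduction mod \<open>2 ^ k\<close>, so adding \<open>h\<close>
  multiplies the weight by a \<open>2 ^ k\<close>-th root of unity. This root is the
  \<open>2 ^ (d - k)\<close>-th power of a single \<open>2 ^ d\<close>-th root, so one number per
  tree serves all depths \<open>k\<close>.\<close>

lemma shift_act_eq:
  assumes F: "is_forest F" and w: "is_weight F w" and x: "x \<in> forest_nodes F"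
  defines "d \<equiv> tree_depth (tree F (tree_index F x))"
  shows "shift_act F h w x =
    exp (2 * pi * \<i> * of_int (h (tree_index F x)) / 2 ^ d) ^ (2 ^ (d - depth F x)) * w x"
proof -
  let ?k = "depth F x" and ?h = "h (tree_index F x)"
  \<comment> \<open>Makes the natural subtraction \<open>d - k\<close> exact, as the splitting of
    \<open>2 ^ d\<close> below requires.\<close>
  have k: "?k \<le> d" unfolding d_def by (rule depth_le_tree_depth[OF F x])
  have "shift_act_additive F h (additive_form F w) x = (?h + additive_form F w x) mod int (2 ^ ?k)"
    by (simp add: shift_act_additive_def mult_integer_mod_group mod_simps)
  then have "shift_act F h w x = exp (2 * pi * \<i> * of_int (?h + additive_form F w x) / 2 ^ ?k)"
    using exp_mod_root[of "2 ^ ?k" "?h + additive_form F w x"] by (simp add: shift_act_def mult_form_def)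
  also have "\<dots> = exp (2 * pi * \<i> * of_int ?h / 2 ^ ?k) * mult_form F (additive_form F w) x"
    by (simp add: mult_form_def distrib_left add_divide_distrib exp_add)
  also have "mult_form F (additive_form F w) x = w x"
    by (rule additive_form(2)[OF F w x])
  also have "(2::complex) ^ d = 2 ^ (d - ?k) * 2 ^ ?k"
    using k by (simp flip: power_add)
  then have "exp (2 * pi * \<i> * of_int ?h / 2 ^ ?k) = exp (2 * pi * \<i> * of_int ?h / 2 ^ d) ^ (2 ^ (d - ?k))"
    by (simp flip: exp_of_nat_mult)
  finally show ?thesis .
qed

theorem proposition5p7:
  fixes F :: "'a forest" and w1 w2 :: "'a \<Rightarrow> complex"
    and g :: "'a \<Rightarrow> 'a" and h :: "nat \<Rightarrow> int"
  assumes "is_forest F"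
    and "g \<in> Aut F"
    and "h \<in> carrier (shift_group F)"
    and "is_weight F w1" and "is_weight F w2"
    and "\<forall>x\<in>forest_nodes F. w2 x = aut_act g (shift_act F h w1) x"
  shows "phi F w1 ` P1_power (num_trees F) = phi F w2 ` P1_power (num_trees F)"
proof (rule phi_image_aut[OF assms(1,2,4,5),
    where \<zeta> = "\<lambda>\<alpha>. exp (2 * pi * \<i> * of_int (h \<alpha>) / 2 ^ tree_depth (tree F \<alpha>))"])
  fix x assume x: "x \<in> forest_nodes F"
  \<comment> \<open>Evaluating at \<open>g x\<close> cancels the inverse of \<open>g\<close> in
    \<open>aut_act\<close>.\<close>
  then have "w2 (g x) = shift_act F h w1 x"
    using assms(6) aut_in[OF assms(1,2)] aut_inj[OF assms(1,2)] by (simp add: aut_act_def)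
  then show "w2 (g x) = exp (2 * pi * \<i> * of_int (h (tree_index F x)) /
      2 ^ tree_depth (tree F (tree_index F x))) ^
      (2 ^ (tree_depth (tree F (tree_index F x)) - depth F x)) * w1 x"
    using shift_act_eq[OF assms(1,4) x] by simp
qed simp

end
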